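(* Let $C_n^2$ be the double-edge cycle graph. The Euler-genus distribution of $C_n^2$ is asymptotically normal with mean $\frac57 n$ and variance $\frac{78}{343}n$ as $n\to\infty$.
   Context: $C_n^2$ is the graph obtained from the cycle graph $C_n$ with $n$ vertices by replacing each edge with a pair of parallel edges (for $n=1$: one vertex with two loops; for $n=2$: two vertices joined by four parallel edges). General cellular embeddings of a connected graph $G$ (on orientable or non-orientable closed surfaces) are described by signed rotation systems, i.e. a cyclic order of the edge-ends around each vertex together with a choice, for each edge, of being twisted or untwisted, counted up to reversing the local orientation at vertices (a uniformly random signed rotation system gives the same Euler-genus distribution). If $f$ is the number of faces, the Euler-genus is $2-|V|+|E|-f$. $\gamma^{E}_G$ denotes the Euler-genus of a uniformly random general embedding of $G$. "Asymptotically normal with mean $e_n$ and variance $v_n$" means that $(\gamma^{E}_{C_n^2}-e_n)/\sqrt{v_n}$ converges in distribution to $\mathcal N(0,1)$ as $n\to\infty$. *)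

theory Defs
  imports "HOL-Probability.Probability" "HOL-Combinatorics.Orbits"
begin

text \<open>
  Finite undirected multigraphs; loops and parallel edges are allowed. Every edge \<open>e\<close> has the two
  edge-ends (darts) \<open>(e, False)\<close> and \<open>(e, True)\<close>, attached to the vertices \<open>endpt G e False\<close> and
  \<open>endpt G e True\<close>. A loop thus contributes two different darts to its vertex.
\<close>

record ('v, 'e) multigraph =
  verts :: "'v set"
  edges :: "'e set"
  endpt :: "'e \<Rightarrow> bool \<Rightarrow> 'v"

type_synonym 'e dart = "'e \<times> bool"

definition darts :: "('v, 'e) multigraph \<Rightarrow> 'e dart set" where
  "darts G = edges G \<times> UNIV"

definition dart_vert :: "('v, 'e) multigraph \<Rightarrow> 'e dart \<Rightarrow> 'v" where
  "dart_vert G d = endpt G (fst d) (snd d)"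

definition darts_at :: "('v, 'e) multigraph \<Rightarrow> 'v \<Rightarrow> 'e dart set" where
  "darts_at G v = {d \<in> darts G. dart_vert G d = v}"

definition opp :: "'e dart \<Rightarrow> 'e dart" where
  "opp d = (fst d, \<not> snd d)"

definition double_cycle :: "nat \<Rightarrow> (nat, nat \<times> bool) multigraph" where
  "double_cycle n =
     \<lparr> verts = {..<n},
       edges = {..<n} \<times> UNIV,
       endpt = (\<lambda>e b. if b then (fst e + 1) mod n else fst e) \<rparr>"


text \<open>
  A signed rotation system is a pair of a permutation \<open>\<rho>\<close> of the darts, whose cycles are the cyclic
  orders around the vertices, and the set \<open>T\<close> of the twisted edges. Since \<^const>\<open>cyclic_on\<close> fails on
  the empty set, the definitions below are meant for connected graphs with at least one edge.
\<close>

type_synonym 'e signed_rotation = "('e dart \<Rightarrow> 'e dart) \<times> 'e set"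

definition signed_rotations :: "('v, 'e) multigraph \<Rightarrow> 'e signed_rotation set" where
  "signed_rotations G =
     {\<rho>. \<rho> permutes darts G \<and> (\<forall>v\<in>verts G. cyclic_on \<rho> (darts_at G v))} \<times> Pow (edges G)"

text \<open>
  Reversing the local orientations at the vertices in \<open>S\<close>: the rotations there are inverted, and
  an edge changes its sign iff exactly one of its two ends lies at a vertex of \<open>S\<close>.
\<close>

fun reverse_at :: "('v, 'e) multigraph \<Rightarrow> 'v set \<Rightarrow> 'e signed_rotation \<Rightarrow> 'e signed_rotation" where
  "reverse_at G S (\<rho>, T) =
     ((\<lambda>d. if dart_vert G d \<in> S then inv \<rho> d else \<rho> d),
      {e \<in> edges G. (e \<in> T) \<noteq> ((endpt G e False \<in> S) \<noteq> (endpt G e True \<in> S))})"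

definition reversal_rel :: "('v, 'e) multigraph \<Rightarrow> ('e signed_rotation \<times> 'e signed_rotation) set" where
  "reversal_rel G = {(R, R'). R \<in> signed_rotations G \<and> (\<exists>S\<subseteq>verts G. R' = reverse_at G S R)}"

definition general_embeddings :: "('v, 'e) multigraph \<Rightarrow> 'e signed_rotation set set" where
  "general_embeddings G = signed_rotations G // reversal_rel G"


text \<open>
  Face tracing. A state \<open>(d, s)\<close> means that the walk leaves a vertex along the dart \<open>d\<close>, where \<open>s\<close>
  tells whether its current orientation agrees with the local orientation at that vertex. It
  traverses the edge, changes \<open>s\<close> if the edge is twisted, and continues with the successor or the
  predecessor of the dart of arrival, depending on the new \<open>s\<close>.
\<close>

fun face_step :: "'e signed_rotation \<Rightarrow> 'e dart \<times> bool \<Rightarrow> 'e dart \<times> bool" where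
  "face_step (\<rho>, T) (d, s) =
     (let s' = (s \<noteq> (fst d \<in> T)) in (if s' then \<rho> (opp d) else inv \<rho> (opp d), s'))"

text \<open>The same edge side traversed backwards.\<close>

fun backwards :: "'e signed_rotation \<Rightarrow> 'e dart \<times> bool \<Rightarrow> 'e dart \<times> bool" where
  "backwards (\<rho>, T) (d, s) = (opp d, \<not> (s \<noteq> (fst d \<in> T)))"

text \<open>
  Every face is traced twice, once in each direction, by two different orbits of \<^const>\<open>face_step\<close>.
  A face is the union of these two orbits.
\<close>

definition faces :: "('v, 'e) multigraph \<Rightarrow> 'e signed_rotation \<Rightarrow> ('e dart \<times> bool) set set" where
  "faces G R =
     (\<lambda>x. orbit (face_step R) x \<union> orbit (face_step R) (backwards R x)) ` (darts G \<times> UNIV)"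

definition euler_genus :: "('v, 'e) multigraph \<Rightarrow> 'e signed_rotation \<Rightarrow> int" where
  "euler_genus G R = 2 - int (card (verts G)) + int (card (edges G)) - int (card (faces G R))"

text \<open>
  The Euler-genus does not depend on the representative of the class, so the image below is a
  singleton for every general embedding.
\<close>

definition embedding_euler_genus :: "('v, 'e) multigraph \<Rightarrow> 'e signed_rotation set \<Rightarrow> int" where
  "embedding_euler_genus G C = the_elem (euler_genus G ` C)"

definition euler_genus_pmf :: "('v, 'e) multigraph \<Rightarrow> int pmf" where
  "euler_genus_pmf G = map_pmf (embedding_euler_genus G) (pmf_of_set (general_embeddings G))"

definition asymptotically_normal ::
    "(nat \<Rightarrow> real pmf) \<Rightarrow> (nat \<Rightarrow> real) \<Rightarrow> (nat \<Rightarrow> real) \<Rightarrow> bool" where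
  "asymptotically_normal X e v \<longleftrightarrow>
     weak_conv_m (\<lambda>n. distr (measure_pmf (X n)) borel (\<lambda>x. (x - e n) / sqrt (v n)))
       std_normal_distribution"

end

theory Submission
  imports Defs
begin

text \<open>
  The faces of a signed rotation system are the components of a graph on the sides of the darts:
  corners and edge sides are two perfect matchings of these points. Cutting \<open>C\<^sub>n\<^sup>2\<close> open at one pair
  of parallel edges changes the number of components by a bounded amount, and eliminating the
  vertices of the remaining chain one by one only requires to remember how the four points at the
  cut are paired. For a uniformly random signed rotation system this pairing is a Markov chain on
  three states, and a loop splits off only when an adjacent-type rotation (the two incoming darts
  are neighbours) meets the pairing \<open>Cross\<close>. Lumping the two pairings of different edges, the
  generating function \<open>y\<^sub>n\<close> of the number of loops satisfies
  \<open>y\<^sub>n\<^sub>+\<^sub>2 = (1/2 + z/3) y\<^sub>n\<^sub>+\<^sub>1 + y\<^sub>n / 6\<close>. Its dominant root at \<open>z = e\<^sup>s\<close> is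
  \<open>e\<^sup>2\<^sup>s\<^sup>/\<^sup>7 (1 + 39/343 s\<^sup>2 + o(s\<^sup>2))\<close>, and the claim follows from Levy's continuity theorem, since the
  Euler-genus is \<open>n\<close> minus the number of loops up to a bounded error. Reversals of local
  orientations act freely on the signed rotation systems, so that all general embeddings have
  equally many representatives.
\<close>

section \<open>Components of graphs\<close>

text \<open>Of the six cyclic orders of four darts two are of opposite and four of adjacent type,
  and the parity of the two twists behind a vertex is a fair coin. So the coin makes every pairing
  of different edges \<open>Cross\<close> or \<open>Straight\<close> with probability 1/2 each. This
  permits the lumping: the lumped state keeps weight 1/2 + z/3, passes to \<open>Own\<close> with
  weight 1/2 * 1/3, and \<open>Own\<close> always leads back to it. At z = 1 the roots are 1 and
  -1/6, so the second one contributes a geometrically small term. The derivative of the dominant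
  root gives 2/7 loops per vertex, hence the mean 1 - 2/7 = 5/7, and 39/343 is half of the variance
  78/343. The obstacle is that a closed cycle has no initial pairing. The closing gap is traded for
  the fictitious pairing \<open>Own\<close> at vertex 0; both touch only the same eight points. The
  resulting bounded error is harmless since the characteristic function multiplies it by a quantity
  of order 1 / sqrt n. Components are counted rather than orbits because equality of two counts can
  then be checked edge by edge with a pair of maps, regardless of the direction of
  traversal.\<close>

definition conn :: "('a \<times> 'a) set \<Rightarrow> ('a \<times> 'a) set" where
  "conn E = (E \<union> E\<inverse>)\<^sup>*"

definition ncomp :: "'a set \<Rightarrow> ('a \<times> 'a) set \<Rightarrow> nat" where
  "ncomp V E = card (V // conn E)"

lemma conn_refl [simp, intro]: "(x, x) \<in> conn E"
  by (simp add: conn_def)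

lemma conn_edge: "(x, y) \<in> E \<Longrightarrow> (x, y) \<in> conn E"
  by (auto simp: conn_def)

lemma conn_sym: "(x, y) \<in> conn E \<Longrightarrow> (y, x) \<in> conn E"
  unfolding conn_def by (meson sym_Un_converse sym_rtrancl symD)

lemma conn_trans [trans]: "(x, y) \<in> conn E \<Longrightarrow> (y, z) \<in> conn E \<Longrightarrow> (x, z) \<in> conn E"
  unfolding conn_def by (rule rtrancl_trans)

lemma equiv_conn: "equiv UNIV (conn E)"
  by (rule equivI) (auto simp: refl_on_def sym_def trans_def intro: conn_sym conn_trans)

lemma conn_class_eq_iff: "conn E `` {x} = conn E `` {y} \<longleftrightarrow> (x, y) \<in> conn E"
  by (rule eq_equiv_class_iff[OF equiv_conn UNIV_I UNIV_I])

lemma conn_mono: "E \<subseteq> F \<Longrightarrow> conn E \<subseteq> conn F"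
  unfolding conn_def by (intro rtrancl_mono) auto

lemma conn_induct [consumes 1, case_names refl step]:
  assumes "(x, y) \<in> conn E" "P x"
    "\<And>y z. (x, y) \<in> conn E \<Longrightarrow> (y, z) \<in> E \<or> (z, y) \<in> E \<Longrightarrow> P y \<Longrightarrow> P z"
  shows "P y"
  using assms(1)[unfolded conn_def]
proof (induction rule: rtrancl_induct)
  case base
  then show ?case using assms(2) .
next
  case (step y z)
  then show ?case using assms(3)[of y z] by (auto simp: conn_def)
qed

lemma conn_step:
  "(x, y) \<in> conn E \<Longrightarrow> (y, z) \<in> E \<or> (z, y) \<in> E \<Longrightarrow> (x, z) \<in> conn E"
  unfolding conn_def by (erule rtrancl_into_rtrancl) auto

lemma conn_map:
  assumes "(x, y) \<in> conn E" and "\<And>u v. (u, v) \<in> E \<Longrightarrow> (g u, g v) \<in> conn F"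
  shows "(g x, g y) \<in> conn F"
  using assms(1)
proof (induction rule: conn_induct)
  case (step y z)
  then have "(g y, g z) \<in> conn F"
    using assms(2)[of y z] conn_sym[OF assms(2)[of z y]] by argo
  with step(3) show ?case by (rule conn_trans)
qed simp

lemma card_image_cong_kernel:
  assumes "\<And>x y. x \<in> A \<Longrightarrow> y \<in> A \<Longrightarrow> f x = f y \<longleftrightarrow> h x = h y"
  shows "card (f ` A) = card (h ` A)"
proof -
  \<comment> \<open>Any preimage may be chosen, since \<open>f\<close> and \<open>h\<close> have the
    same kernel on \<open>A\<close>.\<close>
  have "bij_betw (\<lambda>z. h (SOME x. x \<in> A \<and> f x = z)) (f ` A) (h ` A)"
  proof -
    have *: "h (SOME y. y \<in> A \<and> f y = f x) = h x" if "x \<in> A" for x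
    proof -
      have "(SOME y. y \<in> A \<and> f y = f x) \<in> A \<and> f (SOME y. y \<in> A \<and> f y = f x) = f x"
        by (rule someI[of _ x]) (use that in auto)
      then show ?thesis using assms[of _ x] that by blast
    qed
    show ?thesis
      unfolding bij_betw_def
      by (auto intro!: inj_onI simp: * assms image_iff)
  qed
  then show ?thesis by (rule bij_betw_same_card)
qed

lemma quotient_conn: "V // conn E = (\<lambda>x. conn E `` {x}) ` V"
  by (auto simp: quotient_def)

text \<open>A homotopy equivalence on the level of components: \<open>g\<close> and \<open>s\<close>
  send edges to paths, and both composites move points only within their component, so
  \<open>g\<close> induces a bijection of components. Every contraction and relabelling below is an
  instance.\<close>

lemma ncomp_homotopy:
  assumes E: "E \<subseteq> V \<times> V" "\<And>x y. (x, y) \<in> E \<Longrightarrow> (g x, g y) \<in> conn F"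
    and F: "\<And>x y. (x, y) \<in> F \<Longrightarrow> (s x, s y) \<in> conn E"
    and g: "\<And>x. x \<in> V \<Longrightarrow> g x \<in> W" "\<And>x. x \<in> V \<Longrightarrow> (s (g x), x) \<in> conn E"
    and s: "\<And>w. w \<in> W \<Longrightarrow> s w \<in> V" "\<And>w. w \<in> W \<Longrightarrow> (g (s w), w) \<in> conn F"
  shows "ncomp V E = ncomp W F"
proof -
  have iff: "(x, y) \<in> conn E \<longleftrightarrow> (g x, g y) \<in> conn F" if "x \<in> V" "y \<in> V" for x y
  proof
    assume "(x, y) \<in> conn E"
    then show "(g x, g y) \<in> conn F" by (rule conn_map) (rule E(2))
  next
    assume "(g x, g y) \<in> conn F"
    then have "(s (g x), s (g y)) \<in> conn E" by (rule conn_map) (rule F)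
    then show "(x, y) \<in> conn E"
      using g(2)[OF that(1)] g(2)[OF that(2)] by (meson conn_sym conn_trans)
  qed
  have "W // conn F = (\<lambda>x. conn F `` {g x}) ` V"
  proof -
    have "conn F `` {w} = conn F `` {g (s w)}" if "w \<in> W" for w
      using s(2)[OF that] by (simp add: conn_class_eq_iff conn_sym)
    then show ?thesis
      using s(1) g(1) by (fastforce simp: quotient_conn)
  qed
  then show ?thesis
    unfolding ncomp_def
    by (simp add: quotient_conn) (intro card_image_cong_kernel, simp add: conn_class_eq_iff iff)
qed

text \<open>Serves the loop that splits off at a vertex: \<open>Z\<close> is connected and no edge
  leaves it, so it is exactly one component.\<close>

lemma ncomp_remove_component:
  assumes "finite V" "E \<subseteq> (V - Z) \<times> (V - Z) \<union> Z \<times> Z" "Z \<subseteq> V" "z \<in> Z"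
    and Z: "\<And>x. x \<in> Z \<Longrightarrow> (z, x) \<in> conn E"
  shows "ncomp V E = Suc (ncomp (V - Z) (E \<inter> (V - Z) \<times> (V - Z)))"
proof -
  let ?W = "V - Z" and ?F = "E \<inter> (V - Z) \<times> (V - Z)"
  have out: "(x, y) \<in> conn ?F \<and> y \<in> ?W" if "(x, y) \<in> conn E" "x \<in> ?W" for x y
    using that(1)
  proof (induction rule: conn_induct)
    case refl
    then show ?case using that(2) by simp
  next
    case (step y w)
    then have "(y, w) \<in> ?F \<or> (w, y) \<in> ?F" "w \<in> ?W" using assms(2) by auto
    then show ?case using step(3) conn_step[of x y ?F w] by simp
  qed
  have sub: "conn ?F \<subseteq> conn E" by (rule conn_mono) auto
  have cls: "conn E `` {x} = conn ?F `` {x}" if "x \<in> ?W" for x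
  proof
    show "conn E `` {x} \<subseteq> conn ?F `` {x}" using out[OF _ that] by (simp add: subset_iff)
    show "conn ?F `` {x} \<subseteq> conn E `` {x}" using sub by (rule Image_mono) simp
  qed
  have "(\<lambda>x. conn E `` {x}) ` Z = {conn E `` {z}}"
  proof -
    have "conn E `` {x} = conn E `` {z}" if "x \<in> Z" for x
      using conn_sym[OF Z[OF that]] by (simp only: conn_class_eq_iff)
    then have "(\<lambda>x. conn E `` {x}) ` Z = (\<lambda>x. conn E `` {z}) ` Z" by (rule image_cong[OF refl])
    then show ?thesis using assms(4) by auto
  qed
  moreover have "(\<lambda>x. conn E `` {x}) ` ?W = ?W // conn ?F"
    unfolding quotient_conn using cls by (rule image_cong[OF refl])
  moreover have "V = Z \<union> ?W" using assms(3) by auto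
  ultimately have "V // conn E = insert (conn E `` {z}) (?W // conn ?F)"
    by (metis quotient_conn image_Un insert_is_Un)
  moreover have "conn E `` {z} \<notin> ?W // conn ?F"
  proof
    assume "conn E `` {z} \<in> ?W // conn ?F"
    then obtain x where x: "x \<in> ?W" "conn E `` {z} = conn E `` {x}"
      using cls unfolding quotient_conn by blast
    then have "(x, z) \<in> conn E" by (metis conn_class_eq_iff)
    then show False using out[of x z] x(1) assms(4) by simp
  qed
  moreover have "finite (?W // conn ?F)"
    using assms(1) by (simp add: quotient_conn)
  ultimately show ?thesis by (simp add: ncomp_def)
qed

lemma ncomp_le_card: "finite V \<Longrightarrow> ncomp V E \<le> card V"
  by (simp add: ncomp_def quotient_conn card_image_le)

text \<open>Components avoiding \<open>X\<close> are common to \<open>E\<close> and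
  \<open>E \<union> F\<close>, and at most \<open>card X\<close> components meet \<open>X\<close>.
  As \<open>N\<close> does not involve \<open>F\<close>, two different choices of \<open>F\<close>
  on the same \<open>X\<close> can be compared.\<close>

lemma ncomp_local_change:
  fixes E :: "('a \<times> 'a) set"
  assumes "finite V" "F \<subseteq> X \<times> X" "X \<subseteq> V"
  defines "N \<equiv> card {C \<in> V // conn E. C \<inter> X = {}}"
  shows "N \<le> ncomp V (E \<union> F)" "ncomp V (E \<union> F) \<le> N + card X"
proof -
  let ?Q = "V // conn (E \<union> F)"
  have same: "conn (E \<union> F) `` {x} = conn E `` {x}"
    if x: "conn E `` {x} \<inter> X = {}" for x
  proof
    show "conn (E \<union> F) `` {x} \<subseteq> conn E `` {x}"
    proof clarify
      fix y assume "(x, y) \<in> conn (E \<union> F)"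
      then show "(x, y) \<in> conn E"
      proof (induction rule: conn_induct)
        case (step y w)
        then have "(y, w) \<in> E \<or> (w, y) \<in> E" using x assms(2) by auto
        then show ?case using step(3) conn_step[of x y E w] by simp
      qed auto
    qed
    show "conn E `` {x} \<subseteq> conn (E \<union> F) `` {x}"
      using Image_mono[OF conn_mono[of E "E \<union> F"] subset_refl] by simp
  qed
  have fin: "finite ?Q" using assms(1) by (simp add: quotient_conn)
  have "{C \<in> V // conn E. C \<inter> X = {}} \<subseteq> {C \<in> ?Q. C \<inter> X = {}}"
  proof
    fix C assume "C \<in> {C \<in> V // conn E. C \<inter> X = {}}"
    then have "C \<in> V // conn E" "C \<inter> X = {}" by auto
    from this(1) obtain x where x: "x \<in> V" "C = conn E `` {x}" by (auto simp: quotient_conn)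
    then have "C = conn (E \<union> F) `` {x}" using same \<open>C \<inter> X = {}\<close> by simp
    then show "C \<in> {C \<in> ?Q. C \<inter> X = {}}"
      using x(1) \<open>C \<inter> X = {}\<close> by (simp add: quotient_conn)
  qed
  moreover have "{C \<in> ?Q. C \<inter> X = {}} \<subseteq> {C \<in> V // conn E. C \<inter> X = {}}"
  proof
    fix C assume "C \<in> {C \<in> ?Q. C \<inter> X = {}}"
    then have "C \<in> ?Q" "C \<inter> X = {}" by auto
    from this(1) obtain x where x: "x \<in> V" "C = conn (E \<union> F) `` {x}" by (auto simp: quotient_conn)
    then have "conn E `` {x} \<inter> X = {}"
      using \<open>C \<inter> X = {}\<close> Image_mono[OF conn_mono[of E "E \<union> F"] subset_refl, of "{x}"] by auto
    then have "C = conn E `` {x}" using same x(2) by simp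
    then show "C \<in> {C \<in> V // conn E. C \<inter> X = {}}"
      using x(1) \<open>C \<inter> X = {}\<close> by (simp add: quotient_conn)
  qed
  ultimately have "{C \<in> V // conn E. C \<inter> X = {}} = {C \<in> ?Q. C \<inter> X = {}}"
    by (rule subset_antisym)
  then have N: "N = card {C \<in> ?Q. C \<inter> X = {}}" by (simp only: N_def)
  then show "N \<le> ncomp V (E \<union> F)"
    unfolding ncomp_def using fin by (simp add: card_mono)
  have "{C \<in> ?Q. C \<inter> X \<noteq> {}} \<subseteq> (\<lambda>x. conn (E \<union> F) `` {x}) ` X"
  proof
    fix C assume "C \<in> {C \<in> ?Q. C \<inter> X \<noteq> {}}"
    then obtain y where "C \<in> ?Q" "y \<in> C" "y \<in> X" by auto
    then obtain x where x: "C = conn (E \<union> F) `` {x}" by (auto simp: quotient_conn)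
    then have "C = conn (E \<union> F) `` {y}" using \<open>y \<in> C\<close> by (simp add: conn_class_eq_iff)
    then show "C \<in> (\<lambda>x. conn (E \<union> F) `` {x}) ` X" using \<open>y \<in> X\<close> by (rule image_eqI)
  qed
  moreover have "finite X" using assms(3,1) by (rule finite_subset)
  ultimately have "card {C \<in> ?Q. C \<inter> X \<noteq> {}} \<le> card X"
    by (rule surj_card_le[rotated])
  moreover have "card ?Q = card {C \<in> ?Q. C \<inter> X = {}} + card {C \<in> ?Q. C \<inter> X \<noteq> {}}"
  proof -
    have "?Q = {C \<in> ?Q. C \<inter> X = {}} \<union> {C \<in> ?Q. C \<inter> X \<noteq> {}}" by auto
    then show ?thesis
      using fin by (subst card_Un_disjoint[symmetric]) auto
  qed
  ultimately show "ncomp V (E \<union> F) \<le> N + card X" using N by (simp add: ncomp_def)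
qed

section \<open>Elimination of vertices in a chain\<close>

text \<open>
  At the vertex \<open>v\<close> the dart \<open>(e, b)\<close> belongs to edge number \<open>b\<close> of the pair entering (\<open>e = True\<close>) or leaving
  (\<open>e = False\<close>) \<open>v\<close> along the cycle. The configuration of \<open>v\<close> is the rotation at \<open>v\<close> together with the
  set of twisted edges among the two leaving it. A point \<open>(v, d, s)\<close> is one of the two sides of
  the dart \<open>d\<close> at \<open>v\<close>.
\<close>

type_synonym config = "(bool \<times> bool \<Rightarrow> bool \<times> bool) \<times> bool set"
type_synonym point = "nat \<times> (bool \<times> bool) \<times> bool"

text \<open>The two cyclic orders in which entering and leaving darts alternate.\<close>

definition opp_cycle :: "bool \<Rightarrow> bool \<times> bool \<Rightarrow> bool \<times> bool" where
  "opp_cycle b = (\<lambda>(e, x). if e then (False, x \<noteq> b) else (True, x = b))"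

text \<open>The cycle \<open>(True, b)\<close>, \<open>(True, \<not> b)\<close>,
  \<open>(False, c)\<close>, \<open>(False, \<not> c)\<close>.\<close>

definition adj_cycle :: "bool \<Rightarrow> bool \<Rightarrow> bool \<times> bool \<Rightarrow> bool \<times> bool" where
  "adj_cycle b c = (\<lambda>(e, x). if e then if x = b then (True, \<not> b) else (False, c)
                            else if x = c then (False, \<not> c) else (True, b))"

definition four_cycles :: "(bool \<times> bool \<Rightarrow> bool \<times> bool) set" where
  "four_cycles = {c. cyclic_on c UNIV}"

definition is_opp :: "(bool \<times> bool \<Rightarrow> bool \<times> bool) \<Rightarrow> bool" where
  "is_opp c \<longleftrightarrow> c (c (True, False)) = (True, True)"

lemma is_opp_opp_cycle: "is_opp (opp_cycle b)"
  by (cases b) (simp_all add: is_opp_def opp_cycle_def)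

lemma not_is_opp_adj_cycle: "\<not> is_opp (adj_cycle b c)"
  by (cases b; cases c) (simp_all add: is_opp_def adj_cycle_def)

text \<open>
  After a prefix of the chain has been eliminated, the four points \<open>(b, s)\<close> at the cut are joined
  in pairs: the two sides of the same edge, or sides of different edges with equal or opposite
  values of \<open>s\<close>.
\<close>

datatype pairing = Own | Straight | Cross

fun mate :: "pairing \<Rightarrow> bool \<times> bool \<Rightarrow> bool \<times> bool" where
  "mate Own (b, s) = (b, \<not> s)"
| "mate Straight (b, s) = (\<not> b, s)"
| "mate Cross (b, s) = (\<not> b, \<not> s)"

text \<open>For an adjacent type the corner between the two leaving darts joins sides of different
  edges with opposite signs, which forces \<open>Cross\<close> whatever arrives. For an opposite
  type all corners lead from entering to leaving darts and transport the incoming pairing.\<close>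

definition vertex_step :: "(bool \<times> bool \<Rightarrow> bool \<times> bool) \<Rightarrow> pairing \<Rightarrow> pairing" where
  "vertex_step c m =
     (if is_opp c then (case m of Own \<Rightarrow> Cross | Straight \<Rightarrow> Straight | Cross \<Rightarrow> Own) else Cross)"

text \<open>Passing an edge negates the sign, and a twist cancels the negation. Only a twist of
  exactly one of the two edges changes whether signs on different edges agree.\<close>

definition twist_step :: "bool set \<Rightarrow> pairing \<Rightarrow> pairing" where
  "twist_step S m =
     (if (True \<in> S) = (False \<in> S) then m
      else (case m of Own \<Rightarrow> Own | Straight \<Rightarrow> Cross | Cross \<Rightarrow> Straight))"

text \<open>The corner between two neighbouring entering darts joins two points that
  \<open>Cross\<close> also joins, and so closes up.\<close>

definition loops :: "(bool \<times> bool \<Rightarrow> bool \<times> bool) \<Rightarrow> pairing \<Rightarrow> nat" where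
  "loops c m = (if \<not> is_opp c \<and> m = Cross then 1 else 0)"

definition side :: "nat \<Rightarrow> bool \<Rightarrow> point set" where
  "side v e = {v} \<times> ({e} \<times> UNIV) \<times> UNIV"

definition mate_edges :: "nat \<Rightarrow> bool \<Rightarrow> pairing \<Rightarrow> (point \<times> point) set" where
  "mate_edges v e m = {((v, (e, b), s), (v, (e, b'), s')) | b s b' s'. mate m (b, s) = (b', s')}"

definition corner_edges :: "(nat \<Rightarrow> config) \<Rightarrow> nat set \<Rightarrow> (point \<times> point) set" where
  "corner_edges g I = {((v, d, False), (v, fst (g v) d, True)) | v d. v \<in> I}"

text \<open>The sign rule is that of \<open>backwards\<close>: the same edge side seen from its
  other end.\<close>

definition gap_edges :: "(nat \<Rightarrow> config) \<Rightarrow> nat \<Rightarrow> nat \<Rightarrow> (point \<times> point) set" where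
  "gap_edges g v w = {((v, (False, b), s), (w, (True, b), \<not> (s \<noteq> (b \<in> snd (g v))))) | b s. True}"

section \<open>Passing a gap, a vertex of opposite type, a vertex of adjacent type\<close>

lemma mate_conn:
  "mate m (b, s) = (b', s') \<Longrightarrow> ((v, (e, b), s), (v, (e, b'), s')) \<in> conn (mate_edges v e m \<union> F)"
  by (rule conn_edge) (auto simp: mate_edges_def)

text \<open>Each point on the leaving side of \<open>v\<close> has exactly one gap edge; contracting
  these edges moves the pairing to the next vertex.\<close>

lemma gap_elimination:
  assumes "F \<subseteq> W \<times> W" "side w True \<subseteq> W" "side v False \<inter> W = {}"
  shows "ncomp (side v False \<union> W) (mate_edges v False m \<union> gap_edges g v w \<union> F) =
         ncomp W (mate_edges w True (twist_step (snd (g v)) m) \<union> F)"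
proof -
  \<comment> \<open>The retraction slides every leaving point along its gap edge.\<close>
  define r :: "point \<Rightarrow> point" where "r = (\<lambda>p. if p \<in> side v False then
       (case p of (u, (e, b), s) \<Rightarrow> (w, (True, b), \<not> (s \<noteq> (b \<in> snd (g v))))) else p)"
  have r1: "r (v, (False, b), s) = (w, (True, b), \<not> (s \<noteq> (b \<in> snd (g v))))" for b s
    by (simp add: r_def side_def)
  have r2: "r p = p" if "p \<in> W" for p
    using that assms(3) by (auto simp: r_def)
  have gap: "((v, (False, b), s), (w, (True, b), \<not> (s \<noteq> (b \<in> snd (g v)))))
      \<in> conn (mate_edges v False m \<union> gap_edges g v w \<union> F)" for b s
    by (rule conn_edge) (auto simp: gap_edges_def)
  have mate1: "((v, (False, b), s), (v, (False, b'), s'))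
      \<in> conn (mate_edges v False m \<union> gap_edges g v w \<union> F)" if "mate m (b, s) = (b', s')" for b s b' s'
    using mate_conn[OF that] by (simp add: Un_assoc)
  show ?thesis
  proof (rule ncomp_homotopy[where g = r and s = "\<lambda>x. x"])
    show "mate_edges v False m \<union> gap_edges g v w \<union> F \<subseteq> (side v False \<union> W) \<times> (side v False \<union> W)"
    proof -
      have "(w, (True, b), s) \<in> W" for b s using assms(2) by (auto simp: side_def)
      then have "gap_edges g v w \<subseteq> side v False \<times> W"
        by (auto simp: gap_edges_def side_def)
      moreover have "mate_edges v False m \<subseteq> side v False \<times> side v False"
        by (auto simp: mate_edges_def side_def)
      ultimately show ?thesis using assms(1) by blast
    qed
  next
    fix x y assume "(x, y) \<in> mate_edges v False m \<union> gap_edges g v w \<union> F"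
    then consider "(x, y) \<in> mate_edges v False m" | "(x, y) \<in> gap_edges g v w" | "(x, y) \<in> F" by auto
    then show "(r x, r y) \<in> conn (mate_edges w True (twist_step (snd (g v)) m) \<union> F)"
    proof cases
      case 1
      then obtain b s b' s' where xy: "x = (v, (False, b), s)" "y = (v, (False, b'), s')"
        "mate m (b, s) = (b', s')" by (auto simp: mate_edges_def)
      show ?thesis unfolding xy r1 using xy(3)
        by (intro mate_conn, cases b; cases b'; cases m) (auto simp: twist_step_def)
    next
      case 2
      then obtain b s where xy: "x = (v, (False, b), s)"
        "y = (w, (True, b), \<not> (s \<noteq> (b \<in> snd (g v))))" by (auto simp: gap_edges_def)
      have "y \<in> W" using assms(2) by (auto simp: xy side_def)
      then show ?thesis unfolding xy r1 by (simp add: r2)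
    next
      case 3
      then have "x \<in> W" "y \<in> W" using assms(1) by auto
      then have "r x = x" "r y = y" by (simp_all add: r2)
      then show ?thesis using 3 by (auto intro: conn_edge)
    qed
  next
    fix x y assume "(x, y) \<in> mate_edges w True (twist_step (snd (g v)) m) \<union> F"
    then consider "(x, y) \<in> mate_edges w True (twist_step (snd (g v)) m)" | "(x, y) \<in> F" by auto
    then show "(x, y) \<in> conn (mate_edges v False m \<union> gap_edges g v w \<union> F)"
    proof cases
      case 1
      then obtain b s b' s' where xy: "x = (w, (True, b), s)" "y = (w, (True, b'), s')"
        "mate (twist_step (snd (g v)) m) (b, s) = (b', s')" by (auto simp: mate_edges_def)
      \<comment> \<open>Signs before the gap; the sign change along an edge is an involution, so the
        same formula leads back.\<close>
      define t t' where "t = (\<not> (s \<noteq> (b \<in> snd (g v))))" and "t' = (\<not> (s' \<noteq> (b' \<in> snd (g v))))"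
      have "mate m (b, t) = (b', t')"
        using xy(3) by (cases b; cases b'; cases m) (auto simp: twist_step_def t_def t'_def split: if_splits)
      from mate1[OF this] have "((v, (False, b), t), (v, (False, b'), t'))
        \<in> conn (mate_edges v False m \<union> gap_edges g v w \<union> F)" .
      moreover have "x = (w, (True, b), \<not> (t \<noteq> (b \<in> snd (g v))))"
        "y = (w, (True, b'), \<not> (t' \<noteq> (b' \<in> snd (g v))))"
        by (auto simp: xy t_def t'_def)
      ultimately show ?thesis
        using conn_trans[OF conn_trans[OF conn_sym[OF gap[of b t]]] gap[of b' t']] by simp
    qed (auto intro: conn_edge)
  next
    fix x assume "x \<in> side v False \<union> W"
    then consider b s where "x = (v, (False, b), s)" | "x \<in> W" by (auto simp: side_def)
    then have "r x \<in> W \<and> (r x, x) \<in> conn (mate_edges v False m \<union> gap_edges g v w \<union> F)"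
    proof cases
      case 1
      then have "r x \<in> W" using assms(2) by (auto simp: r1 side_def)
      moreover have "(r x, x) \<in> conn (mate_edges v False m \<union> gap_edges g v w \<union> F)"
        unfolding 1 r1 by (rule conn_sym[OF gap])
      ultimately show ?thesis ..
    qed (simp add: r2)
    then show "r x \<in> W" "(r x, x) \<in> conn (mate_edges v False m \<union> gap_edges g v w \<union> F)"
      by simp_all
  qed (use r2 in auto)
qed


text \<open>All four corners join an entering to a leaving dart, so the corners can be contracted
  like the gaps and no component is lost.\<close>

lemma vertex_elimination_opp:
  assumes F: "F \<subseteq> W \<times> W" "side v False \<subseteq> W" "side v True \<inter> W = {}"
    and g: "fst (g v) = opp_cycle b"
  shows "ncomp (side v True \<union> W) (mate_edges v True m \<union> corner_edges g {v} \<union> F) =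
         ncomp W (mate_edges v False (vertex_step (fst (g v)) m) \<union> F)"
proof -
  let ?E = "mate_edges v True m \<union> corner_edges g {v} \<union> F"
  let ?G = "mate_edges v False (vertex_step (fst (g v)) m) \<union> F"
  \<comment> \<open>Slides an entering point through its corner, to the predecessor dart if
    \<open>s\<close> holds and to the successor otherwise.\<close>
  define r :: "point \<Rightarrow> point" where "r = (\<lambda>p. if p \<in> side v True then
       (case p of (u, (e, x), s) \<Rightarrow> if s then (v, (False, x = b), False) else (v, (False, x \<noteq> b), True))
       else p)"
  have opp: "is_opp (fst (g v))" by (simp add: g is_opp_opp_cycle)
  have r1: "r (v, (True, x), s) = (if s then (v, (False, x = b), False) else (v, (False, x \<noteq> b), True))" for x s
    by (simp add: r_def side_def)
  have r2: "r p = p" if "p \<in> W" for p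
    using that F(3) by (auto simp: r_def)
  have RW: "(v, (False, x), s) \<in> W" for x s using F(2) by (auto simp: side_def)
  have mateE: "((v, (True, x), s), (v, (True, x'), s')) \<in> conn ?E"
    if "mate m (x, s) = (x', s')" for x s x' s'
    using mate_conn[OF that] by (simp add: Un_assoc)
  have cornerE: "((v, d, False), (v, opp_cycle b d, True)) \<in> conn ?E" for d
    by (rule conn_edge, cases d) (auto simp: corner_edges_def g)
  have corner2: "((v, (True, x), s), r (v, (True, x), s)) \<in> conn ?E" for x s
    using cornerE[of "(True, x)"] conn_sym[OF cornerE[of "(False, x = b)"]]
    by (cases x; cases b; cases s; simp add: r1 opp_cycle_def)
  show ?thesis
  proof (rule ncomp_homotopy[where g = r and s = "\<lambda>x. x"])
    have "corner_edges g {v} \<subseteq> (side v True \<union> side v False) \<times> (side v True \<union> side v False)"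
      by (auto simp: corner_edges_def side_def)
    moreover have "mate_edges v True m \<subseteq> side v True \<times> side v True"
      by (auto simp: mate_edges_def side_def)
    ultimately show "?E \<subseteq> (side v True \<union> W) \<times> (side v True \<union> W)"
      using F(1,2) by blast
  next
    fix x y assume "(x, y) \<in> ?E"
    then consider "(x, y) \<in> mate_edges v True m" | "(x, y) \<in> corner_edges g {v}" | "(x, y) \<in> F" by auto
    then show "(r x, r y) \<in> conn ?G"
    proof cases
      case 1
      then obtain z s z' s' where xy: "x = (v, (True, z), s)" "y = (v, (True, z'), s')"
        "mate m (z, s) = (z', s')" by (auto simp: mate_edges_def)
      show ?thesis unfolding xy r1 using xy(3) opp
        by (cases z; cases z'; cases s; cases s'; cases m; cases b)
          (auto simp: vertex_step_def intro!: mate_conn)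
    next
      case 2
      then obtain e z where xy: "x = (v, (e, z), False)" "y = (v, opp_cycle b (e, z), True)"
        by (auto simp: corner_edges_def g)
      have "r x = r y"
        unfolding xy by (cases e; cases z; cases b) (simp_all add: r1 r2 RW opp_cycle_def)
      then show ?thesis by simp
    next
      case 3
      then have "x \<in> W" "y \<in> W" using F(1) by auto
      then show ?thesis using 3 by (auto simp: r2 intro: conn_edge)
    qed
  next
    fix x y assume "(x, y) \<in> ?G"
    then consider "(x, y) \<in> mate_edges v False (vertex_step (fst (g v)) m)" | "(x, y) \<in> F" by auto
    then show "(x, y) \<in> conn ?E"
    proof cases
      case 1
      then obtain z s z' s' where xy: "x = (v, (False, z), s)" "y = (v, (False, z'), s')"
        "mate (vertex_step (fst (g v)) m) (z, s) = (z', s')" by (auto simp: mate_edges_def)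
      \<comment> \<open>\<open>q z s\<close> is the entering point that \<open>r\<close> sends to
        the leaving point \<open>(z, s)\<close>.\<close>
      define q where "q z s = (v, (True, if s then z \<noteq> b else z = b), \<not> s)" for z s
      have "r (q z s) = (v, (False, z), s)" for z s
        by (cases z; cases s; cases b) (simp_all add: q_def r1)
      then have "(q z s, (v, (False, z), s)) \<in> conn ?E" for z s
        using corner2[of "if s then z \<noteq> b else z = b" "\<not> s"] by (simp add: q_def)
      moreover have "(q z s, q z' s') \<in> conn ?E"
        unfolding q_def using xy(3) opp
        by (intro mateE, cases z; cases z'; cases s; cases s'; cases m; cases b)
          (auto simp: vertex_step_def)
      ultimately show ?thesis unfolding xy by (meson conn_sym conn_trans)
    qed (auto intro: conn_edge)
  next
    fix x assume "x \<in> side v True \<union> W"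
    then consider z s where "x = (v, (True, z), s)" | "x \<in> W" by (auto simp: side_def)
    then have "r x \<in> W \<and> (r x, x) \<in> conn ?E"
    proof cases
      case 1
      then show ?thesis using conn_sym[OF corner2] by (simp add: r1 RW)
    qed (simp add: r2)
    then show "r x \<in> W" "(r x, x) \<in> conn ?E" by simp_all
  qed (use r2 in auto)
qed

text \<open>\<open>D\<close> is the part of the entering side that is linked to the rest: the whole
  side if no loop splits off, and the two points outside the loop otherwise. It is connected and
  meets the leaving side in two corners, so it acts as one edge between their ends.\<close>

lemma vertex_elimination_adj_aux:
  fixes m :: pairing
  assumes F: "F \<subseteq> W \<times> W" "side v False \<subseteq> W" "side v True \<inter> W = {}"
    and g: "fst (g v) = adj_cycle b c"
    and D: "D \<subseteq> side v True" "(v, (True, b), True) \<in> D" "(v, (True, \<not> b), False) \<in> D"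
  defines "E \<equiv> (mate_edges v True m \<union> corner_edges g {v} \<union> F) \<inter> (D \<union> W) \<times> (D \<union> W)"
  assumes conn: "\<And>p. p \<in> D \<Longrightarrow> ((v, (True, \<not> b), False), p) \<in> conn E"
  shows "ncomp (D \<union> W) E = ncomp W (mate_edges v False Cross \<union> F)"
proof -
  let ?G = "mate_edges v False Cross \<union> F"
  \<comment> \<open>\<open>D\<close> lies in a single component, so one leaving point at the end of
    a corner can stand for all of it.\<close>
  define r :: "point \<Rightarrow> point" where
    "r = (\<lambda>p. if p \<in> side v True then (v, (False, c), True) else p)"
  have r1: "r (v, (True, x), s) = (v, (False, c), True)" for x s
    by (simp add: r_def side_def)
  have r2: "r p = p" if "p \<in> W" for p
    using that F(3) by (auto simp: r_def)
  have RW: "(v, (False, x), s) \<in> W" for x s using F(2) by (auto simp: side_def)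
  have cornerE: "((v, d, False), (v, adj_cycle b c d, True)) \<in> conn E"
    if "(v, d, False) \<in> D \<union> W" "(v, adj_cycle b c d, True) \<in> D \<union> W" for d
    using that by (intro conn_edge, cases d) (auto simp: E_def corner_edges_def g)
  have c1: "((v, (True, \<not> b), False), (v, (False, c), True)) \<in> conn E"
    using cornerE[of "(True, \<not> b)"] D RW by (simp add: adj_cycle_def)
  have c2: "((v, (False, \<not> c), False), (v, (True, b), True)) \<in> conn E"
    using cornerE[of "(False, \<not> c)"] D RW by (simp add: adj_cycle_def)
  have c3: "((v, (False, c), False), (v, (False, \<not> c), True)) \<in> conn E"
    using cornerE[of "(False, c)"] D RW by (simp add: adj_cycle_def)
  \<comment> \<open>The route through \<open>D\<close> supplies one edge of \<open>Cross\<close>;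
    the other one, \<open>c3\<close>, is the corner between the two leaving darts.\<close>
  have c4: "((v, (False, \<not> c), False), (v, (False, c), True)) \<in> conn E"
    using c1 c2 conn[OF D(2)] by (meson conn_sym conn_trans)
  have mateG: "((v, (False, x), s), (v, (False, \<not> x), \<not> s)) \<in> conn ?G" for x s
    by (rule mate_conn) simp
  show ?thesis
  proof (rule ncomp_homotopy[where g = r and s = "\<lambda>x. x"])
    show "E \<subseteq> (D \<union> W) \<times> (D \<union> W)" by (simp add: E_def)
  next
    fix x y assume "(x, y) \<in> E"
    then consider "(x, y) \<in> mate_edges v True m" | "(x, y) \<in> corner_edges g {v}" | "(x, y) \<in> F"
      by (auto simp: E_def)
    then show "(r x, r y) \<in> conn ?G"
    proof cases
      case 1
      then show ?thesis by (auto simp: mate_edges_def r1)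
    next
      case 2
      then obtain e z where xy: "x = (v, (e, z), False)" "y = (v, adj_cycle b c (e, z), True)"
        by (auto simp: corner_edges_def g)
      show ?thesis
        unfolding xy using mateG[of c True] mateG[of c False] mateG[of "\<not> c" False]
        by (cases e; cases "z = b"; cases "z = c") (auto simp: r1 r2 RW adj_cycle_def)
    next
      case 3
      then have "x \<in> W" "y \<in> W" using F(1) by auto
      then show ?thesis using 3 by (auto simp: r2 intro: conn_edge)
    qed
  next
    fix x y assume "(x, y) \<in> ?G"
    then consider "(x, y) \<in> mate_edges v False Cross" | "(x, y) \<in> F" by auto
    then show "(x, y) \<in> conn E"
    proof cases
      case 1
      then obtain z s where xy: "x = (v, (False, z), s)" "y = (v, (False, \<not> z), \<not> s)"
        by (auto simp: mate_edges_def)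
      show ?thesis unfolding xy using c3 c4 conn_sym[OF c3] conn_sym[OF c4]
        by (cases s; cases z; cases c) auto
    next
      case 2
      then show ?thesis using F(1) by (intro conn_edge) (auto simp: E_def)
    qed
  next
    fix x assume x: "x \<in> D \<union> W"
    show "r x \<in> W"
      using x D(1) by (auto simp: side_def r1 r2 RW)
    show "(r x, x) \<in> conn E"
    proof (cases "x \<in> W")
      case False
      then have "x \<in> D" using x by simp
      then have "r x = (v, (False, c), True)" using D(1) by (auto simp: side_def r1)
      then show ?thesis using conn[OF \<open>x \<in> D\<close>] c1 by (metis conn_sym conn_trans)
    qed (simp add: r2)
  qed (use r2 in auto)
qed


text \<open>For \<open>Own\<close> and \<open>Straight\<close> the mates and the corner between the
  entering darts form a path through all four entering points. For \<open>Cross\<close> that corner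
  runs parallel to a mate edge and the four points fall into a loop and an edge.\<close>

lemma vertex_elimination_adj:
  assumes F: "F \<subseteq> W \<times> W" "side v False \<subseteq> W" "side v True \<inter> W = {}" "finite W"
    and g: "fst (g v) = adj_cycle b c"
  shows "ncomp (side v True \<union> W) (mate_edges v True m \<union> corner_edges g {v} \<union> F) =
         ncomp W (mate_edges v False Cross \<union> F) + (if m = Cross then 1 else 0)"
proof -
  let ?E = "mate_edges v True m \<union> corner_edges g {v} \<union> F" and ?V = "side v True \<union> W"
  have RW: "(v, (False, x), s) \<in> W" for x s using F(2) by (auto simp: side_def)
  have LW: "(v, (True, x), s) \<notin> W" for x s using F(3) by (auto simp: side_def)
  have EV: "?E \<subseteq> ?V \<times> ?V"
  proof -
    have "corner_edges g {v} \<subseteq> (side v True \<union> side v False) \<times> (side v True \<union> side v False)"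
      by (auto simp: corner_edges_def side_def)
    moreover have "mate_edges v True m \<subseteq> side v True \<times> side v True"
      by (auto simp: mate_edges_def side_def)
    ultimately show ?thesis using F(1,2) by blast
  qed
  have mateE: "((v, (True, x), s), (v, (True, x'), s')) \<in> ?E"
    if "mate m (x, s) = (x', s')" for x s x' s'
    using that by (auto simp: mate_edges_def)
  have "((v, (True, b), False), (v, adj_cycle b c (True, b), True)) \<in> ?E"
    by (auto simp: corner_edges_def g)
  then have cornerE: "((v, (True, b), False), (v, (True, \<not> b), True)) \<in> ?E"
    by (simp add: adj_cycle_def)
  show ?thesis
  proof (cases "m = Cross")
    case False
    have *: "((v, (True, \<not> b), False), p) \<in> conn ?E" if "p \<in> side v True" for p
    proof -
      from that obtain x s where p: "p = (v, (True, x), s)" by (auto simp: side_def)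
      show ?thesis
      proof (cases m)
        case Own
        have 1: "((v, (True, \<not> b), False), (v, (True, \<not> b), True)) \<in> conn ?E"
          by (rule conn_edge, rule mateE) (simp add: Own)
        have 2: "((v, (True, \<not> b), False), (v, (True, b), False)) \<in> conn ?E"
          by (rule conn_step[OF 1]) (use cornerE in simp)
        have "((v, (True, b), False), (v, (True, b), True)) \<in> ?E"
          by (rule mateE) (simp add: Own)
        then have "((v, (True, \<not> b), False), (v, (True, b), True)) \<in> conn ?E"
          by (intro conn_step[OF 2]) simp
        with 1 2 show ?thesis unfolding p by (cases s; cases x; cases b) simp_all
      next
        case Straight
        have 1: "((v, (True, \<not> b), False), (v, (True, b), False)) \<in> conn ?E"
          by (rule conn_edge, rule mateE) (simp add: Straight)
        have 2: "((v, (True, \<not> b), False), (v, (True, \<not> b), True)) \<in> conn ?E"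
          by (rule conn_step[OF 1]) (use cornerE in simp)
        have "((v, (True, b), True), (v, (True, \<not> b), True)) \<in> ?E"
          by (rule mateE) (simp add: Straight)
        then have "((v, (True, \<not> b), False), (v, (True, b), True)) \<in> conn ?E"
          by (intro conn_step[OF 2]) simp
        with 1 2 show ?thesis unfolding p by (cases s; cases x; cases b) simp_all
      qed (use False in simp)
    qed
    have R: "?E \<inter> ?V \<times> ?V = ?E" using EV by blast
    show ?thesis
      using vertex_elimination_adj_aux[where D = "side v True" and m = m and v = v and g = g and b = b, OF F(1-3) g] * False unfolding R
      by (simp add: side_def)
  next
    case True
    \<comment> \<open>The loop: these two points are joined both by a corner and by
      \<open>Cross\<close>.\<close>
    let ?Z = "{(v, (True, b), False), (v, (True, \<not> b), True)}"
    let ?D = "{(v, (True, b), True), (v, (True, \<not> b), False)}"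
    have V: "?V - ?Z = ?D \<union> W" using LW by (auto simp: side_def)
    have "ncomp ?V ?E = Suc (ncomp (?V - ?Z) (?E \<inter> (?V - ?Z) \<times> (?V - ?Z)))"
    proof (rule ncomp_remove_component)
      show "finite ?V" using F(4) by (simp add: side_def)
      have "mate_edges v True m \<subseteq> (?D \<union> W) \<times> (?D \<union> W) \<union> ?Z \<times> ?Z"
      proof
        fix e assume "e \<in> mate_edges v True m"
        then obtain z s where "e = ((v, (True, z), s), (v, (True, \<not> z), \<not> s))"
          using True by (auto simp: mate_edges_def)
        then show "e \<in> (?D \<union> W) \<times> (?D \<union> W) \<union> ?Z \<times> ?Z"
          by (cases z; cases b; cases s) simp_all
      qed
      moreover have "corner_edges g {v} \<subseteq> (?D \<union> W) \<times> (?D \<union> W) \<union> ?Z \<times> ?Z"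
      proof
        fix e assume "e \<in> corner_edges g {v}"
        then obtain x z where "e = ((v, (x, z), False), (v, adj_cycle b c (x, z), True))"
          by (auto simp: corner_edges_def g)
        then show "e \<in> (?D \<union> W) \<times> (?D \<union> W) \<union> ?Z \<times> ?Z"
          by (cases x; cases z; cases b; cases c) (simp_all add: adj_cycle_def RW)
      qed
      moreover have "F \<subseteq> (?D \<union> W) \<times> (?D \<union> W) \<union> ?Z \<times> ?Z" using F(1) by blast
      ultimately show "?E \<subseteq> (?V - ?Z) \<times> (?V - ?Z) \<union> ?Z \<times> ?Z"
        unfolding V by (intro Un_least)
      show "?Z \<subseteq> ?V" by (auto simp: side_def)
      show "(v, (True, b), False) \<in> ?Z" by simp
      show "((v, (True, b), False), x) \<in> conn ?E" if "x \<in> ?Z" for x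
        using that conn_edge[OF cornerE] by auto
    qed
    also have "ncomp (?V - ?Z) (?E \<inter> (?V - ?Z) \<times> (?V - ?Z)) = ncomp W (mate_edges v False Cross \<union> F)"
      unfolding V
    proof (rule vertex_elimination_adj_aux[where m = m and v = v and g = g and b = b, OF F(1-3) g])
      fix p assume "p \<in> ?D"
      moreover have "((v, (True, \<not> b), False), (v, (True, b), True))
          \<in> conn (?E \<inter> (?D \<union> W) \<times> (?D \<union> W))"
        using True by (intro conn_edge) (auto simp: mate_edges_def)
      ultimately show "((v, (True, \<not> b), False), p) \<in> conn (?E \<inter> (?D \<union> W) \<times> (?D \<union> W))"
        by auto
    qed (auto simp: side_def)
    finally show ?thesis using True by simp
  qed
qed

section \<open>The six rotations at a vertex\<close>

lemma four_cycles_eq: "four_cycles = range opp_cycle \<union> range (\<lambda>(b, c). adj_cycle b c)"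
proof (intro equalityI subsetI)
  fix c assume "c \<in> four_cycles"
  then have orb: "orbit c x = UNIV" for x
    unfolding four_cycles_def cyclic_on_alldef by blast
  \<comment> \<open>A set that is closed under \<open>c\<close> and contains some \<open>c x\<close>
    is everything. Applied to sets of at most three elements this shows that four successive
    iterates are distinct.\<close>
  have closed: "A = UNIV" if "c x \<in> A" "c ` A \<subseteq> A" for x A
  proof -
    have "y \<in> A" if "y \<in> orbit c x" for y
      using that by induction (use \<open>c x \<in> A\<close> \<open>c ` A \<subseteq> A\<close> in auto)
    then show ?thesis using orb by auto
  qed
  have small: "A \<noteq> UNIV" if "card A < 4" for A :: "(bool \<times> bool) set"
    using that by auto
  have card3: "card {p, q, r} < 4" for p q r :: "bool \<times> bool"
    by (simp add: card_insert_if)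
  have noclose: "\<not> c ` {p, q, r} \<subseteq> {p, q, r}" if "c x \<in> {p, q, r}" for x p q r
    using closed[OF that] small[OF card3] by blast
  define x y z w where "x = (True, False)" and "y = c x" and "z = c y" and "w = c z"
  have 1: "y \<noteq> x" using noclose[of x y y y] by (auto simp: y_def)
  have 2: "z \<noteq> x" "z \<noteq> y" using noclose[of x x y y] noclose[of y y y y] by (auto simp: y_def z_def)
  have 3: "w \<noteq> x" "w \<noteq> y" "w \<noteq> z"
    using noclose[of x x y z] noclose[of y y z z] noclose[of z z z z] by (auto simp: y_def z_def w_def)
  have "c w \<noteq> y" "c w \<noteq> z" "c w \<noteq> w"
    using noclose[of x y z w] noclose[of y z w w] noclose[of z w w w]
    by (auto simp: y_def z_def w_def)
  have all: "u = x \<or> u = y \<or> u = z \<or> u = w" for u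
  proof -
    have "card {x, y, z, w} = card (UNIV :: (bool \<times> bool) set)" using 1 2 3 by simp
    then have "{x, y, z, w} = UNIV" by (intro card_subset_eq) auto
    then show ?thesis by auto
  qed
  have cw: "c w = x" using all[of "c w"] \<open>c w \<noteq> y\<close> \<open>c w \<noteq> z\<close> \<open>c w \<noteq> w\<close> by blast
  have cyc: "c x = y" "c y = z" "c z = w" "c w = x" by (simp_all add: y_def z_def w_def cw[unfolded w_def z_def y_def])
  \<comment> \<open>The type is decided by the distance from \<open>(True, False)\<close> to
    \<open>(True, True)\<close>: two means opposite, one or three means adjacent.\<close>
  have "(\<exists>b. z = (True, True) \<and> y = (False, b) \<and> w = (False, \<not> b)) \<or>
      (\<exists>d. y = (True, True) \<and> z = (False, d) \<and> w = (False, \<not> d)) \<or>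
      (\<exists>d. w = (True, True) \<and> y = (False, d) \<and> z = (False, \<not> d))"
    using 1 2 3 unfolding x_def by (cases y; cases z; cases w) (auto simp: ex_bool_eq)
  then consider b where "z = (True, True)" "y = (False, b)" "w = (False, \<not> b)"
    | d where "y = (True, True)" "z = (False, d)" "w = (False, \<not> d)"
    | d where "w = (True, True)" "y = (False, d)" "z = (False, \<not> d)"
    by blast
  then show "c \<in> range opp_cycle \<union> range (\<lambda>(b, c). adj_cycle b c)"
  proof cases
    case (1 b)
    have "c u = opp_cycle b u" for u
      using all[of u] cyc unfolding 1 x_def by (elim disjE) (simp_all add: opp_cycle_def)
    then show ?thesis by blast
  next
    case (2 d)
    have "c u = adj_cycle False d u" for u
      using all[of u] cyc unfolding 2 x_def by (elim disjE) (simp_all add: adj_cycle_def)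
    then have "c = (\<lambda>(b, c). adj_cycle b c) (False, d)" by auto
    then show ?thesis by blast
  next
    case (3 d)
    have "c u = adj_cycle True d u" for u
      using all[of u] cyc unfolding 3 x_def by (elim disjE) (simp_all add: adj_cycle_def)
    then have "c = (\<lambda>(b, c). adj_cycle b c) (True, d)" by auto
    then show ?thesis by blast
  qed
next
  fix c assume c: "c \<in> range opp_cycle \<union> range (\<lambda>(b, c). adj_cycle b c)"
  let ?x = "(True, False)"
  have o: "c ?x \<in> orbit c ?x" "c (c ?x) \<in> orbit c ?x" "c (c (c ?x)) \<in> orbit c ?x"
    "c (c (c (c ?x))) \<in> orbit c ?x" by (auto intro: orbit.intros)
  have "{c ?x, c (c ?x), c (c (c ?x)), c (c (c (c ?x)))} = UNIV"
  proof -
    have "u \<in> {c ?x, c (c ?x), c (c (c ?x)), c (c (c (c ?x)))}" for u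
      using c by (cases u) (auto simp: opp_cycle_def adj_cycle_def split: if_splits)
    then show ?thesis by blast
  qed
  moreover have "{c ?x, c (c ?x), c (c (c ?x)), c (c (c (c ?x)))} \<subseteq> orbit c ?x" using o by simp
  ultimately have "orbit c ?x = UNIV" by (simp add: top.extremum_unique)
  then show "c \<in> four_cycles" by (auto simp: four_cycles_def cyclic_on_def)
qed

lemma sum_four_cycles:
  fixes h :: "bool \<Rightarrow> 'a :: comm_semiring_1"
  shows "(\<Sum>c\<in>four_cycles. h (is_opp c)) = 2 * h True + 4 * h False"
proof -
  note opp = is_opp_opp_cycle and adj = not_is_opp_adj_cycle
  have inj: "inj opp_cycle"
  proof
    fix b b' assume "opp_cycle b = opp_cycle b'"
    then have "opp_cycle b (True, False) = opp_cycle b' (True, False)" by simp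
    then show "b = b'" by (simp add: opp_cycle_def)
  qed
  have inj2: "inj (\<lambda>(b, c). adj_cycle b c)"
  proof (rule injI, clarify)
    fix b c b' c' assume "adj_cycle b c = adj_cycle b' c'"
    then have "adj_cycle b c u = adj_cycle b' c' u" for u by simp
    from this[of "(True, b)"] this[of "(True, \<not> b)"] show "b = b' \<and> c = c'"
      by (auto simp: adj_cycle_def split: if_splits)
  qed
  have "range opp_cycle \<inter> range (\<lambda>(b, c). adj_cycle b c) = {}"
  proof -
    have "opp_cycle b \<noteq> adj_cycle b' c" for b b' c using opp[of b] adj[of b' c] by metis
    then show ?thesis by auto
  qed
  then have "(\<Sum>c\<in>four_cycles. h (is_opp c)) =
      (\<Sum>c\<in>range opp_cycle. h (is_opp c)) + (\<Sum>c\<in>range (\<lambda>(b, c). adj_cycle b c). h (is_opp c))"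
    unfolding four_cycles_eq by (intro sum.union_disjoint) auto
  also have "(\<Sum>c\<in>range opp_cycle. h (is_opp c)) = 2 * h True"
    using inj by (simp add: sum.reindex opp)
  also have "(\<Sum>c\<in>range (\<lambda>(b, c). adj_cycle b c). h (is_opp c)) = 4 * h False"
    using inj2 by (simp add: sum.reindex adj case_prod_unfold)
  finally show ?thesis .
qed


lemma vertex_elimination:
  assumes "F \<subseteq> W \<times> W" "side v False \<subseteq> W" "side v True \<inter> W = {}" "finite W"
    and "fst (g v) \<in> four_cycles"
  shows "ncomp (side v True \<union> W) (mate_edges v True m \<union> corner_edges g {v} \<union> F) =
         ncomp W (mate_edges v False (vertex_step (fst (g v)) m) \<union> F) + loops (fst (g v)) m"
proof -
  from assms(5) consider b where "fst (g v) = opp_cycle b" | b c where "fst (g v) = adj_cycle b c"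
    unfolding four_cycles_eq by auto
  then show ?thesis
  proof cases
    case (1 b)
    then show ?thesis
      using vertex_elimination_opp[where v = v and g = g and m = m, OF assms(1-3) 1]
      by (simp add: loops_def is_opp_opp_cycle)
  next
    case (2 b c)
    then show ?thesis
      using vertex_elimination_adj[where v = v and g = g and m = m, OF assms(1-4) 2]
      by (simp add: loops_def vertex_step_def not_is_opp_adj_cycle)
  qed
qed

section \<open>Eliminating the whole chain\<close>

definition points :: "nat \<Rightarrow> nat \<Rightarrow> point set" where
  "points k n = {k..<n} \<times> UNIV"

text \<open>The chain is open: the gap from vertex \<open>n - 1\<close> back to 0 is left out, hence
  the upper bound \<open>n - 1\<close> for the gaps.\<close>

definition chain_edges :: "nat \<Rightarrow> (nat \<Rightarrow> config) \<Rightarrow> nat \<Rightarrow> (point \<times> point) set" where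
  "chain_edges n g k = corner_edges g {k..<n} \<union> (\<Union>v\<in>{k..<n - 1}. gap_edges g v (Suc v))"

lemma finite_points [simp]: "finite (points k n)"
  by (simp add: points_def)

lemma points_Suc: "k < n \<Longrightarrow> points k n = side k True \<union> (side k False \<union> points (Suc k) n)"
proof -
  assume "k < n"
  then have "{k..<n} = insert k {Suc k..<n}" by auto
  moreover have "side k True \<union> side k False = {k} \<times> UNIV"
    by (auto simp: side_def)
  ultimately show ?thesis by (auto simp: points_def)
qed

lemma chain_edges_subset: "chain_edges n g k \<subseteq> points k n \<times> points k n"
  by (auto simp: chain_edges_def corner_edges_def gap_edges_def points_def)

lemma chain_edges_Suc:
  assumes "Suc k < n"
  shows "chain_edges n g k = corner_edges g {k} \<union> gap_edges g k (Suc k) \<union> chain_edges n g (Suc k)"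
proof -
  have "{k..<n} = insert k {Suc k..<n}" "{k..<n - 1} = insert k {Suc k..<n - 1}" using assms by auto
  then show ?thesis by (auto simp: chain_edges_def corner_edges_def)
qed

lemma ncomp_chain_step:
  assumes "Suc k < n" "fst (g k) \<in> four_cycles"
  shows "ncomp (points k n) (mate_edges k True m \<union> chain_edges n g k) =
         ncomp (points (Suc k) n) (mate_edges (Suc k) True (twist_step (snd (g k)) (vertex_step (fst (g k)) m))
           \<union> chain_edges n g (Suc k)) + loops (fst (g k)) m"
proof -
  let ?W = "side k False \<union> points (Suc k) n"
  let ?F = "gap_edges g k (Suc k) \<union> chain_edges n g (Suc k)"
  have side: "side (Suc k) True \<subseteq> points (Suc k) n" using assms(1) by (auto simp: side_def points_def)
  have "gap_edges g k (Suc k) \<subseteq> side k False \<times> side (Suc k) True"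
    by (auto simp: gap_edges_def side_def)
  then have F: "?F \<subseteq> ?W \<times> ?W" using side chain_edges_subset[of n g "Suc k"] by blast
  have "ncomp (points k n) (mate_edges k True m \<union> chain_edges n g k) =
      ncomp (side k True \<union> ?W) (mate_edges k True m \<union> corner_edges g {k} \<union> ?F)"
    using assms(1) by (simp add: points_Suc chain_edges_Suc Un_assoc)
  also have "\<dots> = ncomp ?W (mate_edges k False (vertex_step (fst (g k)) m) \<union> ?F) + loops (fst (g k)) m"
    using F assms(2) by (intro vertex_elimination) (auto simp: side_def points_def)
  also have "ncomp ?W (mate_edges k False (vertex_step (fst (g k)) m) \<union> ?F) =
      ncomp ?W (mate_edges k False (vertex_step (fst (g k)) m) \<union> gap_edges g k (Suc k) \<union> chain_edges n g (Suc k))"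
    by (simp add: Un_assoc)
  also have "\<dots> = ncomp (points (Suc k) n)
      (mate_edges (Suc k) True (twist_step (snd (g k)) (vertex_step (fst (g k)) m)) \<union> chain_edges n g (Suc k))"
    using chain_edges_subset side by (intro gap_elimination) (auto simp: side_def points_def)
  finally show ?thesis .
qed

text \<open>The pairing that arrives at vertex \<open>k\<close> and the loops split off before it.
  The start \<open>Own\<close> is fictitious and convenient, since it produces no loop at the vertex
  it meets.\<close>

fun chain_state :: "(nat \<Rightarrow> config) \<Rightarrow> nat \<Rightarrow> pairing \<times> nat" where
  "chain_state g 0 = (Own, 0)"
| "chain_state g (Suc k) = (case chain_state g k of (m, l) \<Rightarrow>
     (twist_step (snd (g k)) (vertex_step (fst (g k)) m), l + loops (fst (g k)) m))"

lemma ncomp_chain: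
  assumes "k < n" "\<And>v. v < n \<Longrightarrow> fst (g v) \<in> four_cycles"
  shows "ncomp (points 0 n) (mate_edges 0 True Own \<union> chain_edges n g 0) =
    ncomp (points k n) (mate_edges k True (fst (chain_state g k)) \<union> chain_edges n g k) + snd (chain_state g k)"
  using assms(1)
proof (induction k)
  case (Suc k)
  then show ?case
    using ncomp_chain_step[of k n g "fst (chain_state g k)"] assms(2)[of k] by (simp add: case_prod_unfold)
qed simp

text \<open>17 = 8 + 8 + 1: the closing gap and the fictitious pairing touch the same eight points,
  the elimination stops with the eight points of the last vertex, and the last step of
  \<open>chain_state\<close> adds at most one loop.\<close>

lemma ncomp_closed_chain:
  assumes "n > 0" "\<And>v. v < n \<Longrightarrow> fst (g v) \<in> four_cycles"
  shows "\<bar>int (ncomp (points 0 n) (chain_edges n g 0 \<union> gap_edges g (n - 1) 0)) - int (snd (chain_state g n))\<bar> \<le> 17"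
proof -
  let ?X = "side 0 True \<union> side (n - 1) False"
  define N where "N = card {C \<in> points 0 n // conn (chain_edges n g 0). C \<inter> ?X = {}}"
  have card: "card (side v e) = 4" for v e by (simp add: side_def card_cartesian_product)
  have X: "card ?X \<le> 8" using card_Un_le[of "side 0 True" "side (n - 1) False"] card by simp
  have sub: "?X \<subseteq> points 0 n" using assms(1) by (auto simp: side_def points_def)
  have m: "mate_edges 0 True Own \<subseteq> ?X \<times> ?X" by (auto simp: mate_edges_def side_def)
  have c: "gap_edges g (n - 1) 0 \<subseteq> ?X \<times> ?X" by (auto simp: gap_edges_def side_def)
  note M = ncomp_local_change[OF finite_points m sub, of "chain_edges n g 0", folded N_def]
  note C = ncomp_local_change[OF finite_points c sub, of "chain_edges n g 0", folded N_def]
  \<comment> \<open>The last vertex is not eliminated, as the open chain has no gap behind it; its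
    points are merely counted.\<close>
  have "ncomp (points (n - 1) n) E \<le> 8" for E
  proof -
    have "{n - 1..<n} = {n - 1}" using assms(1) by auto
    then have "card (points (n - 1) n) = 8" by (simp add: points_def card_cartesian_product)
    then show ?thesis using ncomp_le_card[of "points (n - 1) n" E] by simp
  qed
  from this ncomp_chain[of "n - 1" n g] assms
  obtain d where "d \<le> 8" "ncomp (points 0 n) (chain_edges n g 0 \<union> mate_edges 0 True Own) = d + snd (chain_state g (n - 1))"
    by (auto simp: Un_commute)
  moreover obtain k where k: "n = Suc k" using assms(1) gr0_conv_Suc by auto
  have "snd (chain_state g (n - 1)) \<le> snd (chain_state g n)" "snd (chain_state g n) \<le> snd (chain_state g (n - 1)) + 1"
    by (auto simp: k case_prod_unfold loops_def)
  ultimately show ?thesis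
    using M C X by linarith
qed

section \<open>Faces as components\<close>

text \<open>
  The states of the face tracing as a graph: corner edges at the vertices and edge sides. Both
  together form a union of disjoint cycles, one for each face.
\<close>

definition face_edges ::
  "('v, 'e) multigraph \<Rightarrow> 'e signed_rotation \<Rightarrow> (('e dart \<times> bool) \<times> ('e dart \<times> bool)) set" where
  "face_edges G R =
     {((d, False), (fst R d, True)) | d. d \<in> darts G} \<union> {(x, backwards R x) | x. x \<in> darts G \<times> UNIV}"

lemma opp_opp [simp]: "opp (opp d) = d"
  by (simp add: opp_def)

lemma fst_opp [simp]: "fst (opp d) = fst d"
  by (simp add: opp_def)

lemma opp_in_darts [simp]: "opp d \<in> darts G \<longleftrightarrow> d \<in> darts G"
  by (cases d) (auto simp: opp_def darts_def)

lemma backwards_backwards [simp]: "backwards R (backwards R x) = x"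
  by (cases R; cases x) auto

text \<open>\<open>backwards\<close> is an involution that conjugates \<open>face_step\<close> to
  its inverse, so it maps each orbit to the same face run in the other direction.\<close>

lemma face_step_backwards:
  assumes "bij (fst R)"
  shows "face_step R (backwards R (face_step R x)) = backwards R x"
  using assms
  by (cases R; cases x) (auto simp: Let_def bij_is_inj bij_is_surj surj_f_inv_f)

text \<open>A corner edge joins \<open>backwards R y\<close> to \<open>face_step R y\<close>, so one
  step of the walk follows an edge side and a corner. Conversely, the union of the two orbits is
  closed under both kinds of edges.\<close>

lemma faces_eq_quotient:
  assumes fin: "finite (darts G)" and perm: "fst R permutes darts G"
  shows "faces G R = (darts G \<times> UNIV) // conn (face_edges G R)"
proof -
  let ?D = "darts G \<times> (UNIV :: bool set)" and ?f = "face_step R" and ?\<beta> = "backwards R"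
  obtain \<rho> T where R: "R = (\<rho>, T)" by (cases R)
  have bij: "bij \<rho>" using perm by (simp add: R permutes_bij)
  have inv: "inv \<rho> d \<in> darts G" if "d \<in> darts G" for d
    using perm that by (metis R fst_conv permutes_in_image permutes_inv)
  have \<rho>: "\<rho> d \<in> darts G \<longleftrightarrow> d \<in> darts G" for d
    using perm by (simp add: R permutes_in_image)
  have \<beta>D: "?\<beta> x \<in> ?D" if "x \<in> ?D" for x
    using that by (cases x) (auto simp: R)
  have fD: "?f x \<in> ?D" if "x \<in> ?D" for x
    using that inv by (cases x) (auto simp: R Let_def \<rho>)
  have f\<beta>f: "?f (?\<beta> (?f x)) = ?\<beta> x" for x
    using face_step_backwards[of R x] bij by (simp add: R)
  \<comment> \<open>A left inverse can be read off from the conjugation identity.\<close>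
  have inj: "inj ?f"
    by (rule inj_on_inverseI[where g = "\<lambda>y. ?\<beta> (?f (?\<beta> y))"]) (simp add: f\<beta>f)
  have orbD: "y \<in> ?D" if "y \<in> orbit ?f x" "x \<in> ?D" for x y
    using that by induction (auto intro: fD)
  \<comment> \<open>An orbit begins with the image of its base point, so finiteness and injectivity
    are needed to return to \<open>x\<close> itself.\<close>
  have self: "x \<in> orbit ?f x" if "x \<in> ?D" for x
  proof -
    have "(?f ^^ n) x \<in> ?D" for n
    proof (induction n)
      case (Suc n)
      then show ?case using fD[of "(?f ^^ n) x"] by simp
    qed (use that in simp)
    then have "{y. \<exists>n. y = (?f ^^ n) x} \<subseteq> ?D" by blast
    moreover have "finite ?D" using fin by simp
    ultimately have "finite {y. \<exists>n. y = (?f ^^ n) x}" by (rule finite_subset)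
    then obtain n where "n > 0" "(?f ^^ n) x = x" using funpow_inj_finite[OF inj] by blast
    then show ?thesis unfolding orbit_altdef by (metis (mono_tags, lifting) mem_Collect_eq)
  qed
  have pre: "z \<in> orbit ?f (?f z)" if "z \<in> ?D" for z
    unfolding self_in_orbit_step[OF self[OF that]] using that by (rule self)
  have \<beta>orb: "?\<beta> y \<in> orbit ?f (?\<beta> x)" if "y \<in> orbit ?f x" "x \<in> ?D" for x y
    using that(1)
  proof induction
    case base
    show ?case using pre[OF \<beta>D[OF fD[OF that(2)]]] by (simp add: f\<beta>f)
  next
    case (step y)
    have "?\<beta> (?f y) \<in> orbit ?f (?\<beta> y)"
      using pre[OF \<beta>D[OF fD[OF orbD[OF step(1) that(2)]]]] by (simp add: f\<beta>f)
    then show ?case using step(2) by (rule orbit_trans)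
  qed
  have corner: "((d, False), (\<rho> d, True)) \<in> face_edges G R" if "d \<in> darts G" for d
    unfolding face_edges_def R fst_conv using that by blast
  have "orbit ?f x \<union> orbit ?f (?\<beta> x) = conn (face_edges G R) `` {x}" if x: "x \<in> ?D" for x
  proof -
    have edge: "(y, ?f y) \<in> conn (face_edges G R)" if "y \<in> ?D" for y
    proof -
      have 1: "(y, ?\<beta> y) \<in> conn (face_edges G R)"
        using that by (intro conn_edge) (auto simp: face_edges_def)
      obtain d s where y: "y = (d, s)" by (cases y)
      have "(?\<beta> y, ?f y) \<in> face_edges G R \<or> (?f y, ?\<beta> y) \<in> face_edges G R"
      proof (cases "s \<noteq> (fst d \<in> T)")
        case True
        then have "?\<beta> y = (opp d, False)" "?f y = (\<rho> (opp d), True)"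
          by (auto simp: R y Let_def)
        moreover have "opp d \<in> darts G" using that by (simp add: y)
        ultimately show ?thesis using corner[of "opp d"] by simp
      next
        case False
        then have "?\<beta> y = (opp d, True)" "?f y = (inv \<rho> (opp d), False)"
          by (auto simp: R y Let_def)
        moreover have "\<rho> (inv \<rho> (opp d)) = opp d" using bij by (simp add: bij_is_surj surj_f_inv_f)
        moreover have "inv \<rho> (opp d) \<in> darts G" using that by (simp add: inv y)
        ultimately show ?thesis using corner[of "inv \<rho> (opp d)"] by simp
      qed
      then show ?thesis using conn_step[OF 1] by blast
    qed
    have sub: "orbit ?f y \<subseteq> conn (face_edges G R) `` {y}" if "y \<in> ?D" for y
    proof
      fix z assume "z \<in> orbit ?f y"
      then have "(y, z) \<in> conn (face_edges G R) \<and> z \<in> ?D"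
      proof induction
        case base then show ?case using edge[OF that] fD[OF that] by simp
      next
        case (step z)
        then have "z \<in> ?D" "(y, z) \<in> conn (face_edges G R)" by simp_all
        then show ?case using conn_trans[OF _ edge] fD by simp
      qed
      then show "z \<in> conn (face_edges G R) `` {y}" by simp
    qed
    have x\<beta>: "(x, ?\<beta> x) \<in> conn (face_edges G R)"
      using x by (intro conn_edge) (auto simp: face_edges_def)
    have "conn (face_edges G R) `` {?\<beta> x} = conn (face_edges G R) `` {x}"
      using conn_sym[OF x\<beta>] by (simp only: conn_class_eq_iff)
    then have "orbit ?f x \<union> orbit ?f (?\<beta> x) \<subseteq> conn (face_edges G R) `` {x}"
      using sub[OF x] sub[OF \<beta>D[OF x]] by simp
    moreover have "z \<in> orbit ?f x \<union> orbit ?f (?\<beta> x)" if "(x, z) \<in> conn (face_edges G R)" for z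
      using that
    proof (induction rule: conn_induct)
      case refl
      then show ?case using self[OF x] by simp
    next
      case (step y z)
      let ?O = "orbit ?f x \<union> orbit ?f (?\<beta> x)"
      have O\<beta>: "?\<beta> u \<in> ?O" if "u \<in> ?O" for u
        using that \<beta>orb[of u x] \<beta>orb[of u "?\<beta> x"] x \<beta>D[OF x] by auto
      have Of: "?f u \<in> ?O" if "u \<in> ?O" for u
        using that by (auto intro: orbit.step)
      \<comment> \<open>The neighbours of \<open>y\<close> are its images under two involutions,
        \<open>?\<beta>\<close> for edge sides and \<open>?f\<close> after \<open>?\<beta>\<close>
        for corners.\<close>
      from step(2) consider "z = ?\<beta> y" | "z = ?f (?\<beta> y)"
      proof (elim disjE)
        assume "(y, z) \<in> face_edges G R"
        then show thesis using that by (auto simp: face_edges_def R Let_def)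
      next
        assume "(z, y) \<in> face_edges G R"
        then consider d where "z = (d, False)" "y = (\<rho> d, True)" | "y = ?\<beta> z"
          by (auto simp: face_edges_def R)
        then show thesis
        proof cases
          case 1
          then show thesis using that(2) bij by (auto simp: R Let_def bij_is_inj)
        next
          case 2
          then show thesis using that(1) by simp
        qed
      qed
      then show ?case using O\<beta> Of step(3) by cases blast+
    qed
    ultimately show ?thesis by blast
  qed
  then show ?thesis
    unfolding faces_def quotient_conn by (intro image_cong) auto
qed

section \<open>Coordinates for the double-edge cycle\<close>

text \<open>The flag \<open>e\<close> separates the two ends of an edge even if they lie at the same
  vertex, so the loops for \<open>n = 1\<close> and the four parallel edges for \<open>n = 2\<close>
  need no special treatment.\<close>

fun coord :: "nat \<Rightarrow> (nat \<times> bool) dart \<Rightarrow> nat \<times> (bool \<times> bool)" where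
  "coord n ((j, b), e) = (if e then Suc j mod n else j, (e, b))"

definition prev :: "nat \<Rightarrow> nat \<Rightarrow> nat" where
  "prev n v = (if v = 0 then n - 1 else v - 1)"

fun dart_of :: "nat \<Rightarrow> nat \<times> (bool \<times> bool) \<Rightarrow> (nat \<times> bool) dart" where
  "dart_of n (v, (e, b)) = ((if e then prev n v else v, b), e)"

lemma Suc_prev_mod [simp]: "v < n \<Longrightarrow> Suc (prev n v) mod n = v"
  by (simp add: prev_def)

lemma prev_Suc_mod [simp]: "j < n \<Longrightarrow> prev n (Suc j mod n) = j"
  by (cases "Suc j = n") (auto simp: prev_def)

lemma prev_less [simp]: "v < n \<Longrightarrow> prev n v < n"
  by (auto simp: prev_def)

lemma darts_double_cycle [simp]: "d \<in> darts (double_cycle n) \<longleftrightarrow> fst (fst d) < n"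
  by (cases d) (auto simp: darts_def double_cycle_def)

lemma finite_darts_double_cycle [simp]: "finite (darts (double_cycle n))"
  by (simp add: darts_def double_cycle_def)

lemma dart_vert_double_cycle [simp]: "dart_vert (double_cycle n) d = fst (coord n d)"
  by (cases "(n, d)" rule: coord.cases) (auto simp: dart_vert_def double_cycle_def)

lemma verts_double_cycle [simp]: "verts (double_cycle n) = {..<n}"
  by (simp add: double_cycle_def)

lemma edges_double_cycle [simp]: "edges (double_cycle n) = {..<n} \<times> UNIV"
  by (simp add: double_cycle_def)

lemma coord_dart_of [simp]: "fst p < n \<Longrightarrow> coord n (dart_of n p) = p"
  by (cases "(n, p)" rule: dart_of.cases) simp

lemma dart_of_coord [simp]: "fst (fst d) < n \<Longrightarrow> dart_of n (coord n d) = d"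
  by (cases "(n, d)" rule: coord.cases) simp

lemma fst_coord_less [simp]: "fst (fst d) < n \<Longrightarrow> fst (coord n d) < n"
  by (cases "(n, d)" rule: coord.cases) simp

lemma fst_dart_of_less [simp]: "fst p < n \<Longrightarrow> fst (fst (dart_of n p)) < n"
  by (cases "(n, p)" rule: dart_of.cases) simp

lemma darts_at_double_cycle:
  assumes "v < n"
  shows "darts_at (double_cycle n) v = range (\<lambda>l. dart_of n (v, l))"
proof (intro equalityI subsetI)
  fix d assume "d \<in> darts_at (double_cycle n) v"
  then have d: "fst (fst d) < n" "fst (coord n d) = v" by (auto simp: darts_at_def)
  then have "d = dart_of n (v, snd (coord n d))" by (metis dart_of_coord prod.collapse)
  then show "d \<in> range (\<lambda>l. dart_of n (v, l))" by blast
next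
  fix d assume "d \<in> range (\<lambda>l. dart_of n (v, l))"
  then obtain l where "d = dart_of n (v, l)" by blast
  then show "d \<in> darts_at (double_cycle n) v" using assms by (simp add: darts_at_def del: dart_of.simps)
qed

definition configs :: "config set" where
  "configs = four_cycles \<times> UNIV"

definition rotation_of :: "nat \<Rightarrow> (nat \<Rightarrow> config) \<Rightarrow> (nat \<times> bool) dart \<Rightarrow> (nat \<times> bool) dart" where
  "rotation_of n g d = (if d \<in> darts (double_cycle n)
     then case coord n d of (v, l) \<Rightarrow> dart_of n (v, fst (g v) l) else d)"

definition signed_rotation_of :: "nat \<Rightarrow> (nat \<Rightarrow> config) \<Rightarrow> (nat \<times> bool) signed_rotation" where
  "signed_rotation_of n g = (rotation_of n g, {(j, b). j < n \<and> b \<in> snd (g j)})"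

lemma rotation_of_dart_of:
  "v < n \<Longrightarrow> rotation_of n g (dart_of n (v, l)) = dart_of n (v, fst (g v) l)"
  by (simp add: rotation_of_def del: dart_of.simps)

lemma four_cycles_surj:
  assumes "c \<in> four_cycles"
  shows "\<exists>l. c l = l'"
proof -
  have "l' \<in> orbit c l'" using assms unfolding four_cycles_def cyclic_on_alldef by blast
  then show ?thesis by cases metis+
qed

lemma rotation_of_permutes:
  assumes "\<And>v. v < n \<Longrightarrow> fst (g v) \<in> four_cycles"
  shows "rotation_of n g permutes darts (double_cycle n)"
proof (rule bij_imp_permutes)
  let ?D = "darts (double_cycle n)"
  have "d \<in> rotation_of n g ` ?D" if d: "d \<in> ?D" for d
  proof -
    obtain v l where vl: "coord n d = (v, l)" by (cases "coord n d")
    then have v: "v < n" using fst_coord_less[of d n] d by simp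
    obtain l' where "fst (g v) l' = l" using four_cycles_surj[OF assms[OF v]] by blast
    then have "rotation_of n g (dart_of n (v, l')) = dart_of n (coord n d)"
      using v by (simp add: rotation_of_dart_of vl del: dart_of.simps)
    then have "d = rotation_of n g (dart_of n (v, l'))" using d by simp
    moreover have "dart_of n (v, l') \<in> ?D" using v by (simp del: dart_of.simps)
    ultimately show ?thesis by blast
  qed
  then have sub: "?D \<subseteq> rotation_of n g ` ?D" by blast
  then have "inj_on (rotation_of n g) ?D" by (rule finite_surj_inj[OF finite_darts_double_cycle])
  moreover have "rotation_of n g ` ?D \<subseteq> ?D"
  proof
    fix d assume "d \<in> rotation_of n g ` ?D"
    then obtain d' where "d' \<in> ?D" "d = rotation_of n g d'" by blast
    moreover obtain v l where "coord n d' = (v, l)" by (cases "coord n d'")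
    ultimately show "d \<in> ?D"
      using fst_coord_less[of d' n] by (simp add: rotation_of_def del: dart_of.simps)
  qed
  ultimately show "bij_betw (rotation_of n g) ?D ?D" using sub by (auto simp: bij_betw_def)
qed (simp add: rotation_of_def)

lemma signed_rotation_of_in_signed_rotations:
  assumes "\<And>v. v < n \<Longrightarrow> fst (g v) \<in> four_cycles"
  shows "signed_rotation_of n g \<in> signed_rotations (double_cycle n)"
proof -
  have "cyclic_on (rotation_of n g) (darts_at (double_cycle n) v)" if "v < n" for v
    unfolding darts_at_double_cycle[OF that]
    using assms[OF that]
    by (intro cyclic_on_image[of "fst (g v)"]) (auto simp: four_cycles_def rotation_of_dart_of that)
  then show ?thesis
    using rotation_of_permutes[OF assms] by (auto simp: signed_rotations_def signed_rotation_of_def)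
qed

text \<open>Each edge leaves exactly one vertex, where its sign is stored. A signed rotation system
  thus becomes a family of independent local choices, and the uniform distribution a
  product.\<close>

lemma bij_betw_signed_rotation_of:
  "bij_betw (signed_rotation_of n) ({..<n} \<rightarrow>\<^sub>E configs) (signed_rotations (double_cycle n))"
proof -
  let ?G = "double_cycle n"
  define config_of :: "(nat \<times> bool) signed_rotation \<Rightarrow> nat \<Rightarrow> config" where
    "config_of R = (\<lambda>v\<in>{..<n}. (\<lambda>l. snd (coord n (fst R (dart_of n (v, l)))), {b. (v, b) \<in> snd R}))" for R
  have local: "coord n (fst R d) = (v, snd (coord n (fst R d)))" "fst R d \<in> darts_at ?G v"
    if "R \<in> signed_rotations ?G" "v < n" "d \<in> darts_at ?G v" for R v d
  proof -
    have "cyclic_on (fst R) (darts_at ?G v)" using that by (auto simp: signed_rotations_def)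
    then show *: "fst R d \<in> darts_at ?G v" using that(3) by (rule cyclic_on_inI)
    then have "fst (coord n (fst R d)) = v" by (simp add: darts_at_def)
    then show "coord n (fst R d) = (v, snd (coord n (fst R d)))" by (metis prod.collapse)
  qed
  have in_darts: "fst (fst d) < n" if "d \<in> darts_at ?G v" for d v
    using that by (simp add: darts_at_def)
  show ?thesis
  proof (rule bij_betwI[where g = config_of])
    show "signed_rotation_of n \<in> ({..<n} \<rightarrow>\<^sub>E configs) \<rightarrow> signed_rotations ?G"
    proof
      fix g assume g: "g \<in> {..<n} \<rightarrow>\<^sub>E configs"
      show "signed_rotation_of n g \<in> signed_rotations ?G"
        by (rule signed_rotation_of_in_signed_rotations) (use g in \<open>auto simp: configs_def PiE_iff mem_Times_iff\<close>)
    qed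
  next
    show "config_of \<in> signed_rotations ?G \<rightarrow> {..<n} \<rightarrow>\<^sub>E configs"
    proof
      fix R assume R: "R \<in> signed_rotations ?G"
      have "(\<lambda>l. snd (coord n (fst R (dart_of n (v, l))))) \<in> four_cycles" if v: "v < n" for v
      proof -
        have cyc: "cyclic_on (fst R) (darts_at ?G v)" using R v by (auto simp: signed_rotations_def)
        have "cyclic_on (\<lambda>l. snd (coord n (fst R (dart_of n (v, l))))) ((\<lambda>d. snd (coord n d)) ` darts_at ?G v)"
        proof (rule cyclic_on_image[OF cyc])
          fix d assume "d \<in> darts_at ?G v"
          then have "dart_of n (v, snd (coord n d)) = d"
            by (auto simp: darts_at_double_cycle[OF v] v simp del: dart_of.simps)
          then show "snd (coord n (fst R (dart_of n (v, snd (coord n d))))) = snd (coord n (fst R d))"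
            by simp
        qed
        moreover have "(\<lambda>d. snd (coord n d)) ` darts_at ?G v = UNIV"
          unfolding darts_at_double_cycle[OF v] image_image using v by (simp del: dart_of.simps)
        ultimately show ?thesis by (simp add: four_cycles_def)
      qed
      then show "config_of R \<in> {..<n} \<rightarrow>\<^sub>E configs"
        by (simp add: config_of_def configs_def PiE_iff)
    qed
  next
    fix g assume g: "g \<in> {..<n} \<rightarrow>\<^sub>E configs"
    show "config_of (signed_rotation_of n g) = g"
    proof
      fix v show "config_of (signed_rotation_of n g) v = g v"
      proof (cases "v < n")
        case True
        then show ?thesis
          by (simp add: config_of_def signed_rotation_of_def rotation_of_dart_of del: dart_of.simps)
      next
        case False
        then show ?thesis using PiE_arb[OF g, of v] by (simp add: config_of_def)
      qed
    qed
  next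
    fix R assume R: "R \<in> signed_rotations ?G"
    have "rotation_of n (config_of R) d = fst R d" for d
    proof (cases "d \<in> darts ?G")
      case True
      obtain v l where vl: "coord n d = (v, l)" by (cases "coord n d")
      then have v: "v < n" using fst_coord_less[of d n] True by simp
      have d: "dart_of n (v, l) = d" using True vl by (metis dart_of_coord darts_double_cycle)
      have at: "d \<in> darts_at ?G v" using True vl by (simp add: darts_at_def)
      have "rotation_of n (config_of R) d = dart_of n (v, snd (coord n (fst R d)))"
        using True v d by (simp add: rotation_of_def vl config_of_def del: dart_of.simps)
      also have "\<dots> = fst R d"
        using local[OF R v at] by (metis dart_of_coord in_darts)
      finally show ?thesis .
    next
      case False
      moreover have "fst R permutes darts ?G" using R by (auto simp: signed_rotations_def)
      ultimately show ?thesis using permutes_not_in[of "fst R" "darts ?G" d] by (simp add: rotation_of_def)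
    qed
    then have "rotation_of n (config_of R) = fst R" by (rule ext)
    moreover have "snd R \<subseteq> {..<n} \<times> UNIV" using R by (auto simp: signed_rotations_def)
    then have "{(j, b). j < n \<and> b \<in> snd (config_of R j)} = snd R"
      by (auto simp: config_of_def)
    ultimately show "signed_rotation_of n (config_of R) = R"
      by (simp add: signed_rotation_of_def)
  qed
qed

lemma closed_chain_edges:
  assumes "n > 0"
  shows "chain_edges n g 0 \<union> gap_edges g (n - 1) 0 =
    corner_edges g {..<n} \<union> (\<Union>v<n. gap_edges g v (Suc v mod n))"
proof -
  have "{..<n} = insert (n - 1) {0..<n - 1}" using assms by auto
  then have "(\<Union>v<n. gap_edges g v (Suc v mod n)) =
      gap_edges g (n - 1) 0 \<union> (\<Union>v\<in>{0..<n - 1}. gap_edges g v (Suc v mod n))"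
    using assms by simp
  also have "(\<Union>v\<in>{0..<n - 1}. gap_edges g v (Suc v mod n)) = (\<Union>v\<in>{0..<n - 1}. gap_edges g v (Suc v))"
    by (intro SUP_cong) auto
  finally show ?thesis by (auto simp: chain_edges_def atLeast0LessThan)
qed

lemma card_faces_signed_rotation_of:
  assumes n: "n > 0" and g: "\<And>v. v < n \<Longrightarrow> fst (g v) \<in> four_cycles"
  shows "card (faces (double_cycle n) (signed_rotation_of n g)) =
    ncomp (points 0 n) (chain_edges n g 0 \<union> gap_edges g (n - 1) 0)"
proof -
  let ?G = "double_cycle n"
  let ?E = "face_edges ?G (signed_rotation_of n g)"
  let ?F = "corner_edges g {..<n} \<union> (\<Union>v<n. gap_edges g v (Suc v mod n))"
  let ?r = "\<lambda>(d, s :: bool). (fst (coord n d), snd (coord n d), s)"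
  let ?s = "\<lambda>(v, l, s). (dart_of n (v, l), s)"
  have "ncomp (darts ?G \<times> UNIV) ?E = ncomp (points 0 n) ?F"
  proof (rule ncomp_homotopy[where g = ?r and s = ?s])
    have "rotation_of n g d \<in> darts ?G" if "d \<in> darts ?G" for d
      using rotation_of_permutes[of n g] g that by (simp add: permutes_in_image del: darts_double_cycle)
    moreover have "backwards (signed_rotation_of n g) x \<in> darts ?G \<times> UNIV" if "x \<in> darts ?G \<times> UNIV" for x
      using that by (cases x) (auto simp: signed_rotation_of_def simp del: darts_double_cycle)
    ultimately show "?E \<subseteq> (darts ?G \<times> UNIV) \<times> (darts ?G \<times> UNIV)"
      unfolding face_edges_def by (auto simp: signed_rotation_of_def simp del: darts_double_cycle)
  next
    fix x y assume "(x, y) \<in> ?E"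
    then consider d where "x = (d, False)" "y = (rotation_of n g d, True)" "d \<in> darts ?G"
      | j b e s where "x = (((j, b), e), s)" "y = backwards (signed_rotation_of n g) (((j, b), e), s)" "j < n"
      by (auto simp: face_edges_def signed_rotation_of_def)
    then show "(?r x, ?r y) \<in> conn ?F"
    proof cases
      case (1 d)
      obtain v l where vl: "coord n d = (v, l)" by (cases "coord n d")
      then have "v < n" using fst_coord_less[of d n] 1 by simp
      then have "?r y = (v, fst (g v) l, True)" "?r x = (v, l, False)"
        using 1 vl by (simp_all add: rotation_of_def del: dart_of.simps)
      then show ?thesis using \<open>v < n\<close> by (cases l) (auto intro!: conn_edge simp: corner_edges_def)
    next
      case (2 j b e s)
      let ?t = "\<not> (s \<noteq> (b \<in> snd (g j)))"
      have gap: "((j, (False, b), u), (Suc j mod n, (True, b), \<not> (u \<noteq> (b \<in> snd (g j))))) \<in> ?F" for u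
        using 2(3) by (auto simp: gap_edges_def)
      have y: "y = (((j, b), \<not> e), ?t)" using 2 by (simp add: signed_rotation_of_def opp_def)
      show ?thesis
      proof (cases e)
        case True
        \<comment> \<open>The gap edge is entered at its far end, so its near end must carry the
          sign \<open>?t\<close>.\<close>
        have "((j, (False, b), ?t), (Suc j mod n, (True, b), s)) \<in> ?F"
          using gap[of ?t] by (cases s; cases "b \<in> snd (g j)") simp_all
        then show ?thesis unfolding 2(1) y using True by (simp add: conn_sym[OF conn_edge])
      next
        case False
        with gap[of s] show ?thesis unfolding 2(1) y by (auto intro: conn_edge)
      qed
    qed
  next
    fix x y assume "(x, y) \<in> ?F"
    then consider v l where "x = (v, l, False)" "y = (v, fst (g v) l, True)" "v < n"
      | v b s where "x = (v, (False, b), s)" "y = (Suc v mod n, (True, b), \<not> (s \<noteq> (b \<in> snd (g v))))" "v < n"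
      by (auto simp: corner_edges_def gap_edges_def)
    then show "(?s x, ?s y) \<in> conn ?E"
    proof cases
      case (1 v l)
      have "dart_of n (v, l) \<in> darts ?G" using 1 by (simp del: dart_of.simps)
      then have "((dart_of n (v, l), False), (rotation_of n g (dart_of n (v, l)), True)) \<in> ?E"
        unfolding face_edges_def signed_rotation_of_def fst_conv by blast
      then show ?thesis using 1 by (auto simp: rotation_of_dart_of simp del: dart_of.simps intro: conn_edge)
    next
      case (2 v b s)
      have x: "?s x = (((v, b), False), s)" using 2 by simp
      have "?s y = backwards (signed_rotation_of n g) (((v, b), False), s)"
        using 2 by (auto simp: signed_rotation_of_def opp_def)
      moreover have "((((v, b), False), s), backwards (signed_rotation_of n g) (((v, b), False), s)) \<in> ?E"
        using 2(3) unfolding face_edges_def by auto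
      ultimately show ?thesis unfolding x by (auto intro: conn_edge)
    qed
  next
    fix x assume "x \<in> darts ?G \<times> (UNIV :: bool set)"
    then show "?r x \<in> points 0 n" "(?s (?r x), x) \<in> conn ?E"
      by (auto simp: points_def simp del: coord.simps dart_of.simps)
  next
    fix w assume "w \<in> points 0 n"
    then show "?s w \<in> darts ?G \<times> UNIV" "(?r (?s w), w) \<in> conn ?F"
      by (auto simp: points_def simp del: coord.simps dart_of.simps)
  qed
  moreover have "faces ?G (signed_rotation_of n g) = (darts ?G \<times> UNIV) // conn ?E"
    by (rule faces_eq_quotient) (simp_all add: signed_rotation_of_def rotation_of_permutes g)
  ultimately show ?thesis unfolding closed_chain_edges[OF n] by (simp add: ncomp_def)
qed

section \<open>Reversal classes\<close>

text \<open>The degree bound is what makes reversals free: a cyclic order of one or two darts is its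
  own inverse.\<close>

locale min_degree_3 =
  fixes G :: "('v, 'e) multigraph"
  assumes finite_verts: "finite (verts G)"
    and finite_edges: "finite (edges G)"
    and endpt_in_verts: "e \<in> edges G \<Longrightarrow> endpt G e b \<in> verts G"
    and degree: "v \<in> verts G \<Longrightarrow> 3 \<le> card (darts_at G v)"
begin

lemma finite_darts: "finite (darts G)"
  by (simp add: darts_def finite_edges)

lemma finite_signed_rotations: "finite (signed_rotations G)"
proof -
  have "signed_rotations G \<subseteq> {\<rho>. \<rho> permutes darts G} \<times> Pow (edges G)"
    by (auto simp: signed_rotations_def)
  then show ?thesis
    using finite_permutations[OF finite_darts] finite_edges by (auto intro: finite_subset)
qed

lemma signed_rotationsD:
  assumes "(\<rho>, T) \<in> signed_rotations G"
  shows "\<rho> permutes darts G" "T \<subseteq> edges G"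
    "\<And>v. v \<in> verts G \<Longrightarrow> cyclic_on \<rho> (darts_at G v)"
  using assms by (auto simp: signed_rotations_def)

lemma dart_vert_rotation:
  assumes "(\<rho>, T) \<in> signed_rotations G"
  shows "dart_vert G (\<rho> d) = dart_vert G d" "dart_vert G (inv \<rho> d) = dart_vert G d"
proof -
  note R = signed_rotationsD[OF assms]
  have *: "dart_vert G (\<rho> d) = dart_vert G d" for d
  proof (cases "d \<in> darts G")
    case True
    then have "dart_vert G d \<in> verts G"
      by (auto simp: dart_vert_def darts_def endpt_in_verts)
    from cyclic_on_inI[OF R(3)[OF this], of d] True show ?thesis by (simp add: darts_at_def)
  next
    case False
    then show ?thesis using R(1) by (simp add: permutes_not_in)
  qed
  show "dart_vert G (\<rho> d) = dart_vert G d" by (rule *)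
  show "dart_vert G (inv \<rho> d) = dart_vert G d"
    using *[of "inv \<rho> d"] R(1) by (simp add: permutes_inverses)
qed

text \<open>Since \<open>\<rho>\<close> preserves the vertex of a dart, a partially reversed
  rotation can be inverted vertex by vertex.\<close>

lemma inv_reversed_rotation:
  fixes S :: "'v set"
  assumes "(\<rho>, T) \<in> signed_rotations G"
  defines "\<rho>' \<equiv> \<lambda>d. if dart_vert G d \<in> S then inv \<rho> d else \<rho> d"
  shows "bij \<rho>'" "inv \<rho>' = (\<lambda>d. if dart_vert G d \<in> S then \<rho> d else inv \<rho> d)"
proof -
  let ?i = "\<lambda>d. if dart_vert G d \<in> S then \<rho> d else inv \<rho> d"
  have "?i (\<rho>' d) = d" "\<rho>' (?i d) = d" for d
    using permutes_inverses[OF signed_rotationsD(1)[OF assms(1)]] dart_vert_rotation[OF assms(1)]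
    by (auto simp: \<rho>'_def)
  then have "?i \<circ> \<rho>' = id" "\<rho>' \<circ> ?i = id" by (auto simp: fun_eq_iff)
  then show "bij \<rho>'" "inv \<rho>' = ?i" by (auto intro: o_bij inv_unique_comp)
qed

lemma reverse_at_signed_rotations:
  assumes "R \<in> signed_rotations G"
  shows "reverse_at G S R \<in> signed_rotations G"
proof -
  obtain \<rho> T where R: "R = (\<rho>, T)" by (cases R)
  note R' = signed_rotationsD[OF assms[unfolded R]]
  let ?r = "\<lambda>d. if dart_vert G d \<in> S then inv \<rho> d else \<rho> d"
  have "?r permutes darts G"
  proof -
    have "?r d = d" if "d \<notin> darts G" for d
      using that permutes_not_in[OF R'(1)] permutes_not_in[OF permutes_inv[OF R'(1)]] by simp
    then show ?thesis
      using inv_reversed_rotation(1)[OF assms[unfolded R], of S]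
      unfolding permutes_def bij_iff by blast
  qed
  moreover have "cyclic_on ?r (darts_at G v)" if v: "v \<in> verts G" for v
  proof (cases "v \<in> S")
    case True
    have "permutation \<rho>" using R'(1) finite_darts by (auto simp: permutation_permutes)
    then have "cyclic_on (inv \<rho>) (darts_at G v)"
      using R'(3)[OF v] by (simp add: cyclic_on_def orbit_inv_eq)
    moreover have "cyclic_on ?r (darts_at G v) = cyclic_on (inv \<rho>) (darts_at G v)"
      by (rule cyclic_cong) (use True in \<open>auto simp: darts_at_def\<close>)
    ultimately show ?thesis by simp
  next
    case False
    have "cyclic_on ?r (darts_at G v) = cyclic_on \<rho> (darts_at G v)"
      by (rule cyclic_cong) (use False in \<open>auto simp: darts_at_def\<close>)
    then show ?thesis using R'(3)[OF v] by simp
  qed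
  ultimately show ?thesis by (auto simp: R signed_rotations_def)
qed

text \<open>Symmetric difference makes the vertex sets an elementary abelian 2-group; the reversal
  classes are the orbits of its action.\<close>

lemma reverse_at_reverse_at:
  assumes "R \<in> signed_rotations G"
  shows "reverse_at G S (reverse_at G S' R) = reverse_at G ((S - S') \<union> (S' - S)) R"
proof -
  obtain \<rho> T where R: "R = (\<rho>, T)" by (cases R)
  note inv = inv_reversed_rotation(2)[OF assms[unfolded R], of S']
  show ?thesis by (auto simp: R fun_eq_iff inv)
qed

lemma reverse_at_empty: "R \<in> signed_rotations G \<Longrightarrow> reverse_at G {} R = R"
  by (cases R) (auto simp: signed_rotations_def)

lemma equiv_reversal_rel: "equiv (signed_rotations G) (reversal_rel G)"
proof (rule equivI)
  show "reversal_rel G \<subseteq> signed_rotations G \<times> signed_rotations G"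
    by (auto simp: reversal_rel_def reverse_at_signed_rotations simp del: reverse_at.simps)
  show "refl_on (signed_rotations G) (reversal_rel G)"
  proof (rule refl_onI)
    fix R assume "R \<in> signed_rotations G"
    then show "(R, R) \<in> reversal_rel G"
      using reverse_at_empty[of R] unfolding reversal_rel_def by (auto intro!: exI[of _ "{}"])
  qed
  show "sym (reversal_rel G)"
  proof (rule symI)
    fix R R' assume "(R, R') \<in> reversal_rel G"
    then obtain S where R: "R \<in> signed_rotations G" "S \<subseteq> verts G" "R' = reverse_at G S R"
      by (auto simp: reversal_rel_def)
    then have "R = reverse_at G S R'" by (simp add: reverse_at_reverse_at reverse_at_empty)
    then show "(R', R) \<in> reversal_rel G"
      using R reverse_at_signed_rotations by (auto simp: reversal_rel_def)
  qed
  show "trans (reversal_rel G)"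
  proof (rule transI)
    fix R R' R'' assume "(R, R') \<in> reversal_rel G" "(R', R'') \<in> reversal_rel G"
    then obtain S S' where R: "R \<in> signed_rotations G" "S \<subseteq> verts G" "S' \<subseteq> verts G"
      "R'' = reverse_at G S' (reverse_at G S R)"
      by (auto simp: reversal_rel_def)
    then have "R'' = reverse_at G ((S' - S) \<union> (S - S')) R" by (simp add: reverse_at_reverse_at)
    then show "(R, R'') \<in> reversal_rel G"
      using R unfolding reversal_rel_def by (auto intro!: exI[of _ "(S' - S) \<union> (S - S')"])
  qed
qed

text \<open>A cyclic permutation of at least three darts differs from its inverse, so reversals act freely.\<close>

lemma inj_on_reverse_at:
  assumes "R \<in> signed_rotations G"
  shows "inj_on (\<lambda>S. reverse_at G S R) (Pow (verts G))"
proof -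
  obtain \<rho> T where R: "R = (\<rho>, T)" by (cases R)
  note R' = signed_rotationsD[OF assms[unfolded R]]
  have ne: "\<exists>d\<in>darts_at G v. inv \<rho> d \<noteq> \<rho> d" if v: "v \<in> verts G" for v
  proof (rule ccontr)
    assume "\<not> ?thesis"
    then have inv: "inv \<rho> d = \<rho> d" if "d \<in> darts_at G v" for d using that by blast
    obtain d where d: "d \<in> darts_at G v" "darts_at G v = orbit \<rho> d"
      using R'(3)[OF v] by (auto simp: cyclic_on_def)
    \<comment> \<open>If \<open>\<rho>\<close> agreed with its inverse at \<open>v\<close>, its
      square would fix \<open>d\<close> and the orbit would have at most two darts.\<close>
    have "\<rho> (\<rho> d) = d"
      using inv[OF d(1)] permutes_inverses(1)[OF R'(1)] by metis
    then have closed: "\<rho> e \<in> {d, \<rho> d}" if "e \<in> {d, \<rho> d}" for e using that by auto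
    have "e \<in> {d, \<rho> d}" if "e \<in> orbit \<rho> d" for e
      using that
    proof induction
      case (step y)
      from step(2) show ?case by (rule closed)
    qed simp
    then have "darts_at G v \<subseteq> {d, \<rho> d}" using d(2) by blast
    then have "card (darts_at G v) \<le> card {d, \<rho> d}" by (intro card_mono) auto
    also have "\<dots> \<le> 2" by (simp add: card_insert_if)
    finally show False using degree[OF v] by simp
  qed
  show ?thesis
  proof (rule inj_onI)
    fix S S' assume S: "S \<in> Pow (verts G)" "S' \<in> Pow (verts G)"
      and eq: "reverse_at G S R = reverse_at G S' R"
    have "v \<in> S \<longleftrightarrow> v \<in> S'" if v: "v \<in> verts G" for v
    proof -
      obtain d where d: "d \<in> darts_at G v" "inv \<rho> d \<noteq> \<rho> d" using ne[OF v] by blast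
      have "(if dart_vert G d \<in> S then inv \<rho> d else \<rho> d) =
          (if dart_vert G d \<in> S' then inv \<rho> d else \<rho> d)"
        using arg_cong[OF eq, of "\<lambda>R. fst R d"] by (simp add: R)
      then show ?thesis using d by (auto simp: darts_at_def split: if_splits)
    qed
    then show "S = S'" using S by auto
  qed
qed

lemma card_general_embedding:
  assumes "C \<in> general_embeddings G"
  shows "card C = 2 ^ card (verts G)"
proof -
  obtain R where R: "R \<in> signed_rotations G" "C = reversal_rel G `` {R}"
    using assms by (auto simp: general_embeddings_def quotient_def)
  then have "C = (\<lambda>S. reverse_at G S R) ` Pow (verts G)"
    by (auto simp: reversal_rel_def)
  then show ?thesis
    using inj_on_reverse_at[OF R(1)] by (simp add: card_image card_Pow finite_verts)
qed

text \<open>Reversing a vertex exchanges the two sides of its darts. Negating \<open>s\<close>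
  exactly at the darts in \<open>S\<close> carries corners to corners, run backwards inside
  \<open>S\<close>, and edge sides to edge sides.\<close>

lemma face_edges_reverse_at:
  assumes R: "R \<in> signed_rotations G" and xy: "(x, y) \<in> face_edges G R"
  shows "((fst x, snd x \<noteq> (dart_vert G (fst x) \<in> S)), (fst y, snd y \<noteq> (dart_vert G (fst y) \<in> S)))
    \<in> conn (face_edges G (reverse_at G S R))"
proof -
  obtain \<rho> T where R': "R = (\<rho>, T)" by (cases R)
  let ?E = "face_edges G (reverse_at G S R)"
  note perm = signed_rotationsD(1)[OF R[unfolded R']]
  note vert = dart_vert_rotation(1)[OF R[unfolded R']]
  from xy consider d where "x = (d, False)" "y = (\<rho> d, True)" "d \<in> darts G"
    | d s where "x = (d, s)" "y = backwards R (d, s)" "d \<in> darts G"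
    by (auto simp: face_edges_def R')
  then show ?thesis
  proof cases
    case (1 d)
    show ?thesis
    proof (cases "dart_vert G d \<in> S")
      case True
      have "\<rho> d \<in> darts G" using perm 1(3) by (simp add: permutes_in_image)
      then have "((\<rho> d, False), (fst (reverse_at G S R) (\<rho> d), True)) \<in> ?E"
        unfolding face_edges_def by blast
      also have "fst (reverse_at G S R) (\<rho> d) = d"
        using True vert[of d] permutes_inverses(2)[OF perm] by (simp add: R')
      finally show ?thesis using 1 True vert[of d] by (simp add: conn_sym[OF conn_edge])
    next
      case False
      have "((d, False), (fst (reverse_at G S R) d, True)) \<in> ?E"
        unfolding face_edges_def using 1(3) by blast
      then show ?thesis using 1 False vert[of d] by (simp add: conn_edge R')
    qed
  next
    case (2 d s)
    have d: "fst d \<in> edges G" using 2(3) by (auto simp: darts_def)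
    have "((d, s \<noteq> (dart_vert G d \<in> S)), backwards (reverse_at G S R) (d, s \<noteq> (dart_vert G d \<in> S))) \<in> ?E"
      unfolding face_edges_def using 2(3) by blast
    also have "backwards (reverse_at G S R) (d, s \<noteq> (dart_vert G d \<in> S)) =
        (fst y, snd y \<noteq> (dart_vert G (fst y) \<in> S))"
      using d by (cases d; cases "snd d") (auto simp: 2 R' dart_vert_def opp_def)
    finally show ?thesis using 2 by (simp add: conn_edge)
  qed
qed

lemma euler_genus_reverse_at:
  assumes R: "R \<in> signed_rotations G"
  shows "euler_genus G (reverse_at G S R) = euler_genus G R"
proof -
  let ?R' = "reverse_at G S R"
  let ?g = "\<lambda>x. (fst x, snd x \<noteq> (dart_vert G (fst x) \<in> S))"
  have R': "?R' \<in> signed_rotations G" using R by (rule reverse_at_signed_rotations)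
  have undo: "reverse_at G S ?R' = R"
    using R by (simp add: reverse_at_reverse_at reverse_at_empty)
  have perm: "fst Q permutes darts G" if "Q \<in> signed_rotations G" for Q
    using that by (auto simp: signed_rotations_def)
  have gg: "?g (?g x) = x" for x by (cases x) auto
  have "ncomp (darts G \<times> UNIV) (face_edges G R) = ncomp (darts G \<times> UNIV) (face_edges G ?R')"
  proof (rule ncomp_homotopy[where g = ?g and s = ?g])
    have "fst R d \<in> darts G" if "d \<in> darts G" for d
      using perm[OF R] that by (simp add: permutes_in_image)
    moreover have "backwards R x \<in> darts G \<times> UNIV" if "x \<in> darts G \<times> UNIV" for x
      using that by (cases R; cases x) auto
    ultimately show "face_edges G R \<subseteq> (darts G \<times> UNIV) \<times> (darts G \<times> UNIV)"
      unfolding face_edges_def by blast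
    show "(?g x, ?g y) \<in> conn (face_edges G ?R')" if "(x, y) \<in> face_edges G R" for x y
      using R that by (rule face_edges_reverse_at)
    show "(?g x, ?g y) \<in> conn (face_edges G R)" if "(x, y) \<in> face_edges G ?R'" for x y
      using face_edges_reverse_at[OF R' that, of S] unfolding undo .
  qed (unfold gg, auto)
  then show ?thesis
    using faces_eq_quotient[OF finite_darts perm[OF R]] faces_eq_quotient[OF finite_darts perm[OF R']]
    by (simp add: euler_genus_def ncomp_def)
qed

lemma embedding_euler_genus_eq:
  assumes "C \<in> general_embeddings G" "R \<in> C"
  shows "embedding_euler_genus G C = euler_genus G R"
proof -
  obtain Q where Q: "Q \<in> signed_rotations G" "C = reversal_rel G `` {Q}"
    using assms by (auto simp: general_embeddings_def quotient_def)
  then have "euler_genus G R' = euler_genus G Q" if "R' \<in> C" for R'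
    using that by (auto simp: reversal_rel_def euler_genus_reverse_at)
  then have "euler_genus G ` C = {euler_genus G R}" using assms(2) by auto
  then show ?thesis by (simp add: embedding_euler_genus_def)
qed

section \<open>Averages over embeddings as averages over signed rotation systems\<close>

lemma sum_signed_rotations:
  fixes F :: "int \<Rightarrow> 'a :: comm_semiring_1"
  shows "(\<Sum>R\<in>signed_rotations G. F (euler_genus G R)) =
    2 ^ card (verts G) * (\<Sum>C\<in>general_embeddings G. F (embedding_euler_genus G C))"
proof -
  have fin: "finite C" if "C \<in> general_embeddings G" for C
    using finite_signed_rotations that Union_quotient[OF equiv_reversal_rel]
    by (metis Sup_upper finite_subset general_embeddings_def)
  have "(\<Sum>R\<in>signed_rotations G. F (euler_genus G R)) =
      (\<Sum>R\<in>\<Union>(general_embeddings G). F (euler_genus G R))"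
    using Union_quotient[OF equiv_reversal_rel] by (simp add: general_embeddings_def)
  also have "\<dots> = (\<Sum>C\<in>general_embeddings G. \<Sum>R\<in>C. F (euler_genus G R))"
    using quotient_disj[OF equiv_reversal_rel] fin
    by (subst sum.Union_disjoint) (auto simp: general_embeddings_def)
  also have "\<dots> = (\<Sum>C\<in>general_embeddings G. 2 ^ card (verts G) * F (embedding_euler_genus G C))"
    by (intro sum.cong) (auto simp: card_general_embedding simp flip: embedding_euler_genus_eq)
  finally show ?thesis by (simp add: sum_distrib_left)
qed

lemma integral_euler_genus_pmf:
  fixes F :: "int \<Rightarrow> complex"
  assumes "signed_rotations G \<noteq> {}"
  shows "(LINT k|measure_pmf (euler_genus_pmf G). F k) =
    (\<Sum>R\<in>signed_rotations G. F (euler_genus G R)) / of_nat (card (signed_rotations G))"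
proof -
  let ?S = "general_embeddings G"
  have fin: "finite ?S"
    unfolding general_embeddings_def using finite_signed_rotations
    by (rule finite_quotient) (use equiv_reversal_rel in \<open>auto elim: equivE\<close>)
  have ne: "?S \<noteq> {}" using assms by (auto simp: general_embeddings_def quotient_def)
  have "of_nat (card (signed_rotations G)) = (2 ^ card (verts G) * of_nat (card ?S) :: complex)"
    using sum_signed_rotations[of "\<lambda>_. 1 :: complex"] by simp
  moreover have "(LINT k|measure_pmf (euler_genus_pmf G). F k) =
      (\<Sum>C\<in>?S. F (embedding_euler_genus G C)) / of_nat (card ?S)"
  proof -
    have "(LINT k|measure_pmf (euler_genus_pmf G). F k) =
        (LINT C|measure_pmf (pmf_of_set ?S). F (embedding_euler_genus G C))"
      by (simp add: euler_genus_pmf_def)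
    also have "\<dots> = (\<Sum>C\<in>?S. pmf (pmf_of_set ?S) C *\<^sub>R F (embedding_euler_genus G C))"
      using fin ne by (intro integral_measure_pmf) auto
    also have "\<dots> = (\<Sum>C\<in>?S. F (embedding_euler_genus G C) / of_nat (card ?S))"
      using fin ne by (intro sum.cong) (auto simp: scaleR_conv_of_real divide_inverse mult.commute)
    finally show ?thesis by (simp add: sum_divide_distrib)
  qed
  ultimately show ?thesis by (simp add: sum_signed_rotations)
qed

end

section \<open>Asymptotics of the generating function\<close>

text \<open>The probability generating function of the number of loops.\<close>

fun loop_poly :: "complex \<Rightarrow> nat \<Rightarrow> complex" where
  "loop_poly z 0 = 1"
| "loop_poly z (Suc 0) = 1"
| "loop_poly z (Suc (Suc n)) = (1 / 2 + z / 3) * loop_poly z (Suc n) + loop_poly z n / 6"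

text \<open>The coefficients a and b of the two powers solve a + b = 1 and a * l1 + b * l2 = 1,
  which are the two initial values.\<close>

lemma loop_poly_roots:
  assumes "l1 + l2 = 1 / 2 + z / 3" "l1 * l2 = - 1 / 6" "l1 \<noteq> l2"
  shows "loop_poly z n = (1 - l2) / (l1 - l2) * l1 ^ n + (l1 - 1) / (l1 - l2) * l2 ^ n"
proof (induction n rule: induct_nat_012)
  case 0
  then show ?case using assms(3) by (simp add: divide_simps)
next
  case 1
  have "(1 - l2) * l1 + (l1 - 1) * l2 = l1 - l2" by (simp add: algebra_simps)
  then have "((1 - l2) * l1 + (l1 - 1) * l2) / (l1 - l2) = 1" using assms(3) by simp
  then show ?case by (simp add: add_divide_distrib)
next
  case (ge2 n)
  have *: "l ^ Suc (Suc n) = (1 / 2 + z / 3) * l ^ Suc n + l ^ n / 6" if "l = l1 \<or> l = l2" for l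
  proof -
    have "l ^ 2 = (l1 + l2) * l - l1 * l2"
      using that by (auto simp: power2_eq_square algebra_simps)
    then have "l ^ 2 = (1 / 2 + z / 3) * l + 1 / 6" by (simp add: assms(1,2))
    then have "l ^ 2 * l ^ n = ((1 / 2 + z / 3) * l + 1 / 6) * l ^ n" by (rule arg_cong)
    then show ?thesis by (simp add: algebra_simps power2_eq_square)
  qed
  define a b where "a = (1 - l2) / (l1 - l2)" and "b = (l1 - 1) / (l1 - l2)"
  have "loop_poly z (Suc (Suc n)) =
      (1 / 2 + z / 3) * (a * l1 ^ Suc n + b * l2 ^ Suc n) + (a * l1 ^ n + b * l2 ^ n) / 6"
    by (simp only: loop_poly.simps ge2 a_def b_def)
  also have "\<dots> = a * ((1 / 2 + z / 3) * l1 ^ Suc n + l1 ^ n / 6) + b * ((1 / 2 + z / 3) * l2 ^ Suc n + l2 ^ n / 6)"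
    by (simp add: algebra_simps add_divide_distrib)
  also have "\<dots> = a * l1 ^ Suc (Suc n) + b * l2 ^ Suc (Suc n)"
    by (simp only: *[OF disjI1[OF refl]] *[OF disjI2[OF refl]])
  finally show ?case by (simp only: a_def b_def)
qed

lemma exp_taylor_2:
  fixes k :: complex
  shows "((\<lambda>s. (exp (k * s) - 1 - k * s) / s\<^sup>2) \<longlongrightarrow> k\<^sup>2 / 2) (at 0)"
proof (rule Lim_null[THEN iffD2], rule Lim_null_comparison)
  \<comment> \<open>The cubic Taylor remainder divided by the square of \<open>norm s\<close>,
    without the factor 1/2.\<close>
  let ?B = "\<lambda>s::complex. exp (norm (k * s)) * norm k ^ 3 * norm s"
  show "\<forall>\<^sub>F s in at 0. norm ((exp (k * s) - 1 - k * s) / s\<^sup>2 - k\<^sup>2 / 2) \<le> ?B s"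
  proof (rule eventually_at_topological[THEN iffD2], intro exI conjI ballI impI)
    fix s :: complex assume "s \<noteq> 0"
    have "(exp (k * s) - 1 - k * s) / s\<^sup>2 - k\<^sup>2 / 2 = (exp (k * s) - (1 + k * s + (k * s)\<^sup>2 / 2)) / s\<^sup>2"
      using \<open>s \<noteq> 0\<close> by (simp add: field_simps power_mult_distrib)
    also have "1 + k * s + (k * s)\<^sup>2 / 2 = (\<Sum>i\<le>2. (k * s) ^ i / fact i)"
      by (simp add: numeral_2_eq_2)
    also have "norm ((exp (k * s) - \<dots>) / s\<^sup>2) \<le>
        exp \<bar>Re (k * s)\<bar> * norm (k * s) ^ Suc 2 / fact 2 / norm s ^ 2"
      unfolding norm_divide norm_power by (intro divide_right_mono Taylor_exp) simp
    also have "\<dots> \<le> exp (norm (k * s)) * norm (k * s) ^ Suc 2 / 1 / norm s ^ 2"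
    proof -
      have "exp \<bar>Re (k * s)\<bar> \<le> exp (norm (k * s))"
        by (subst exp_le_cancel_iff) (rule abs_Re_le_cmod)
      then show ?thesis by (intro divide_right_mono frac_le mult_right_mono) simp_all
    qed
    also have "\<dots> = ?B s"
      using \<open>s \<noteq> 0\<close> by (simp add: norm_mult power_mult_distrib field_simps eval_nat_numeral)
    finally show "norm ((exp (k * s) - 1 - k * s) / s\<^sup>2 - k\<^sup>2 / 2) \<le> ?B s" .
  qed (rule open_UNIV, auto)
  show "(?B \<longlongrightarrow> 0) (at 0)"
    by (rule tendsto_eq_intros refl | simp)+
qed

text \<open>Square root of the discriminant of the characteristic quadratic. At 0 the radicand is
  25/36 + 24/36 = 49/36, where the principal branch is continuous.\<close>

definition discr :: "complex \<Rightarrow> complex" where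
  "discr s = csqrt ((1 / 2 + exp s / 3)\<^sup>2 + 2 / 3)"

definition root1 :: "complex \<Rightarrow> complex" where
  "root1 s = ((1 / 2 + exp s / 3) + discr s) / 2"

definition root2 :: "complex \<Rightarrow> complex" where
  "root2 s = ((1 / 2 + exp s / 3) - discr s) / 2"

lemma root_sum: "root1 s + root2 s = 1 / 2 + exp s / 3"
  by (simp add: root1_def root2_def field_simps)

lemma root_prod: "root1 s * root2 s = - 1 / 6"
proof -
  have "root1 s * root2 s = ((1 / 2 + exp s / 3)\<^sup>2 - (discr s)\<^sup>2) / 4"
    unfolding root1_def root2_def by (simp add: power2_eq_square algebra_simps)
  also have "\<dots> = - 1 / 6" by (simp add: discr_def)
  finally show ?thesis .
qed

lemma csqrt_49: "csqrt (49 / 36) = 7 / 6"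
proof -
  have "csqrt (49 / 36) = csqrt ((7 / 6)\<^sup>2)" by (simp add: power2_eq_square)
  also have "\<dots> = 7 / 6" by (rule csqrt_square) simp
  finally show ?thesis .
qed

lemma tendsto_discr: "(discr \<longlongrightarrow> 7 / 6) (at 0)"
proof -
  have "isCont discr 0"
    unfolding discr_def by (intro continuous_intros isCont_csqrt') (auto simp: complex_nonpos_Reals_iff power2_eq_square)
  then show ?thesis by (simp add: isCont_def discr_def csqrt_49 power2_eq_square)
qed

lemma tendsto_root1: "(root1 \<longlongrightarrow> 1) (at 0)"
  unfolding root1_def by (rule tendsto_eq_intros tendsto_discr refl | simp)+

lemma tendsto_root2: "(root2 \<longlongrightarrow> - 1 / 6) (at 0)"
  unfolding root2_def by (rule tendsto_eq_intros tendsto_discr refl | simp)+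

text \<open>
  Put \<open>u = exp (- 2 s / 7)\<close>. The quadratic with the roots \<open>root1 s * u\<close> and \<open>root2 s * u\<close> takes a value of
  order \<open>o(s\<^sup>2)\<close> at \<open>1 + 39/343 s\<^sup>2\<close>, while \<open>root2 s * u\<close> stays away from \<open>1\<close>.
\<close>

lemma root1_expansion:
  "((\<lambda>s. (root1 s * exp (- (2 / 7) * s) - 1) / s\<^sup>2) \<longlongrightarrow> 39 / 343) (at 0)"
proof -
  define c :: complex where "c = 39 / 343"
  define E :: "complex \<Rightarrow> complex \<Rightarrow> complex" where "E k s = (exp (k * s) - 1 - k * s) / s\<^sup>2" for k s
  \<comment> \<open>The value of the quadratic at 1 + c s^2, divided by s^2 and written with the
    remainders \<open>E\<close>. Its linear terms cancel, 1/7 - 5/21 + 2/21 = 0, which fixes the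
    exponent 2/7; its limit (7/6) c - 39/294 vanishes, which fixes \<open>c\<close>.\<close>
  define Q where "Q s = 2 * c + c\<^sup>2 * s\<^sup>2 - (E (-2/7) s / 2 + E (5/7) s / 3)
    - (exp (- (2/7) * s) / 2 + exp ((5/7) * s) / 3) * c - E (-4/7) s / 6" for s
  define d where "d s = 1 + c * s\<^sup>2 - root2 s * exp (- (2/7) * s)" for s
  have E: "(E k \<longlongrightarrow> k\<^sup>2 / 2) (at 0)" for k
    unfolding E_def by (rule exp_taylor_2)
  have "(Q \<longlongrightarrow> 0) (at 0)"
    unfolding Q_def by (rule tendsto_eq_intros E refl | simp add: c_def power2_eq_square)+
  moreover have d: "(d \<longlongrightarrow> 7 / 6) (at 0)"
    unfolding d_def by (rule tendsto_eq_intros tendsto_root2 refl | simp)+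
  ultimately have lim: "((\<lambda>s. c - Q s / d s) \<longlongrightarrow> c) (at 0)"
    by (auto intro!: tendsto_eq_intros)
  have "\<forall>\<^sub>F s in at 0. d s \<noteq> 0" by (rule tendsto_imp_eventually_ne[OF d]) simp
  moreover have "\<forall>\<^sub>F s in at (0::complex). s \<noteq> 0" by (simp add: eventually_at_filter)
  ultimately have "\<forall>\<^sub>F s in at 0. c - Q s / d s = (root1 s * exp (- (2 / 7) * s) - 1) / s\<^sup>2"
  proof eventually_elim
    case (elim s)
    define x u w where "x = 1 + c * s\<^sup>2" and "u = exp (- (2/7) * s)" and "w = exp ((5/7) * s)"
    have u2: "exp (- (4/7) * s) = u * u" by (simp add: u_def flip: exp_add)
    have w: "exp s * u = w" by (simp add: u_def w_def flip: exp_add)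
    have Es: "E k s * s\<^sup>2 = exp (k * s) - 1 - k * s" for k
      using elim by (simp add: E_def)
    have "(x - root1 s * u) * (x - root2 s * u) =
        x\<^sup>2 - (root1 s + root2 s) * u * x + (root1 s * root2 s) * (u * u)"
      by (simp add: algebra_simps power2_eq_square)
    also have "\<dots> = x\<^sup>2 - (u / 2 + w / 3) * x - u * u / 6"
      by (simp add: root_sum root_prod algebra_simps flip: w)
    also have "\<dots> = Q s * s\<^sup>2"
    proof -
      have "Q s * s\<^sup>2 = 2 * c * s\<^sup>2 + c\<^sup>2 * s\<^sup>2 * s\<^sup>2 - (E (-2/7) s * s\<^sup>2 / 2 + E (5/7) s * s\<^sup>2 / 3)
          - (u / 2 + w / 3) * c * s\<^sup>2 - E (-4/7) s * s\<^sup>2 / 6"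
        by (simp add: Q_def u_def w_def algebra_simps)
      also have "\<dots> = 2 * c * s\<^sup>2 + c\<^sup>2 * s\<^sup>2 * s\<^sup>2 - ((u - 1 + (2/7) * s) / 2 + (w - 1 - (5/7) * s) / 3)
          - (u / 2 + w / 3) * c * s\<^sup>2 - (u * u - 1 + (4/7) * s) / 6"
        unfolding Es using u2 by (simp add: u_def w_def)
      also have "\<dots> = x\<^sup>2 - (u / 2 + w / 3) * x - u * u / 6"
        by (simp add: x_def power2_eq_square field_simps)
      finally show ?thesis by simp
    qed
    finally have "(x - root1 s * u) * d s = Q s * s\<^sup>2" by (simp add: d_def x_def u_def)
    then have "x - root1 s * u = Q s * s\<^sup>2 / d s" using elim by (simp add: field_simps)
    then have "root1 s * u - 1 = (c - Q s / d s) * s\<^sup>2" by (simp add: x_def algebra_simps)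
    then show ?case using elim by (simp add: u_def)
  qed
  then show ?thesis using lim unfolding c_def by (rule Lim_transform_eventually[rotated])
qed

text \<open>The limit of (1 + w/n)^n with a complex perturbation, obtained from Ln y being
  asymptotic to y - 1 at 1.\<close>

lemma tendsto_power_exp:
  fixes x :: "nat \<Rightarrow> complex"
  assumes "(\<lambda>n. of_nat n * (x n - 1)) \<longlonglongrightarrow> w"
  shows "(\<lambda>n. x n ^ n) \<longlonglongrightarrow> exp w"
proof -
  \<comment> \<open>The removable singularity is filled so that \<open>Ln y = (y - 1) * h y\<close>
    also holds at \<open>y = 1\<close>.\<close>
  define h :: "complex \<Rightarrow> complex" where "h y = (if y = 1 then 1 else Ln y / (y - 1))" for y
  have "x \<longlonglongrightarrow> 1"
  proof -
    have "(\<lambda>n. of_nat n * (x n - 1) * inverse (of_nat n)) \<longlonglongrightarrow> w * 0"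
      by (intro tendsto_mult assms lim_inverse_n)
    moreover have "\<forall>\<^sub>F n in sequentially. of_nat n * (x n - 1) * inverse (of_nat n) = x n - 1"
      using eventually_gt_at_top[of 0] by eventually_elim auto
    ultimately have "(\<lambda>n. x n - 1) \<longlonglongrightarrow> 0" by (auto intro: Lim_transform_eventually)
    then show ?thesis by (rule Lim_null[THEN iffD2])
  qed
  have "(h \<longlongrightarrow> 1) (at 1)"
  proof -
    have "(Ln has_field_derivative 1) (at 1)"
      using has_field_derivative_Ln[of 1] by simp
    then have "((\<lambda>y. Ln y / (y - 1)) \<longlongrightarrow> 1) (at 1)"
      by (simp add: has_field_derivative_iff)
    then show ?thesis
      by (rule Lim_transform_eventually) (auto simp: h_def eventually_at_filter)
  qed
  then have "isCont h 1" by (simp add: isCont_def h_def)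
  then have "(\<lambda>n. h (x n)) \<longlonglongrightarrow> 1"
    using isCont_tendsto_compose[of 1 h x] \<open>x \<longlonglongrightarrow> 1\<close> by (simp add: h_def)
  then have "(\<lambda>n. exp (of_nat n * (x n - 1) * h (x n))) \<longlonglongrightarrow> exp (w * 1)"
    by (intro tendsto_exp tendsto_mult assms)
  moreover have "\<forall>\<^sub>F n in sequentially. x n \<noteq> 0"
    by (rule tendsto_imp_eventually_ne[OF \<open>x \<longlonglongrightarrow> 1\<close>]) simp
  then have "\<forall>\<^sub>F n in sequentially. exp (of_nat n * (x n - 1) * h (x n)) = x n ^ n"
  proof eventually_elim
    case (elim n)
    have "(x n - 1) * h (x n) = Ln (x n)" by (simp add: h_def)
    then show ?case using elim by (simp add: exp_of_nat_mult mult.assoc)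
  qed
  ultimately show ?thesis by (simp add: Lim_transform_eventually)
qed

text \<open>The factor with 2/7 centres the number of loops. With s =
  \<open>\<i> * \<theta> n\<close> the product n s^2 tends to -v, so the n-th power of 1 + 39/343
  s^2 + o(s^2) converges to the stated exponential.\<close>

lemma loop_poly_asymptotics:
  fixes \<theta> :: "nat \<Rightarrow> real"
  assumes "\<theta> \<longlonglongrightarrow> 0" "\<And>n. n > 0 \<Longrightarrow> \<theta> n \<noteq> 0"
    and "(\<lambda>n. real n * (\<theta> n)\<^sup>2) \<longlonglongrightarrow> v"
  shows "(\<lambda>n. exp (- (2 / 7) * \<i> * \<theta> n) ^ n * loop_poly (exp (\<i> * \<theta> n)) n) \<longlonglongrightarrow> exp (- (39 / 343) * complex_of_real v)"
proof -
  define s :: "nat \<Rightarrow> complex" where "s n = \<i> * \<theta> n" for n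
  define u where "u n = exp (- (2 / 7) * s n)" for n
  define a b where "a n = (1 - root2 (s n)) / (root1 (s n) - root2 (s n))"
    and "b n = (root1 (s n) - 1) / (root1 (s n) - root2 (s n))" for n
  have s: "filterlim s (at 0) sequentially"
    unfolding filterlim_at s_def using assms(1,2)
    by (auto intro!: tendsto_eq_intros eventually_mono[OF eventually_gt_at_top[of 0]])
  note r1 = filterlim_compose[OF tendsto_root1 s]
  note r2 = filterlim_compose[OF tendsto_root2 s]
  have a: "a \<longlonglongrightarrow> 1" and b: "b \<longlonglongrightarrow> 0"
    unfolding a_def b_def by (rule tendsto_eq_intros r1 r2 refl | simp)+
  have ns2: "(\<lambda>n. of_nat n * (s n)\<^sup>2) \<longlonglongrightarrow> - complex_of_real v"
  proof -
    have "(\<lambda>n. - complex_of_real (real n * (\<theta> n)\<^sup>2)) \<longlonglongrightarrow> - complex_of_real v"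
      by (intro tendsto_intros assms)
    then show ?thesis by (simp add: s_def power_mult_distrib)
  qed
  have main: "(\<lambda>n. (root1 (s n) * u n) ^ n) \<longlonglongrightarrow> exp (- (39 / 343) * complex_of_real v)"
  proof (rule tendsto_power_exp)
    have "(\<lambda>n. of_nat n * (s n)\<^sup>2 * ((root1 (s n) * u n - 1) / (s n)\<^sup>2)) \<longlonglongrightarrow> - complex_of_real v * (39 / 343)"
      unfolding u_def by (intro tendsto_mult ns2 filterlim_compose[OF root1_expansion s])
    moreover have "\<forall>\<^sub>F n in sequentially.
        of_nat n * (s n)\<^sup>2 * ((root1 (s n) * u n - 1) / (s n)\<^sup>2) = of_nat n * (root1 (s n) * u n - 1)"
      using eventually_gt_at_top[of 0] by eventually_elim (use assms(2) in \<open>simp add: s_def\<close>)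
    ultimately show "(\<lambda>n. of_nat n * (root1 (s n) * u n - 1)) \<longlonglongrightarrow> - (39 / 343) * complex_of_real v"
      by (simp add: Lim_transform_eventually mult.commute)
  qed
  have small: "(\<lambda>n. (root2 (s n) * u n) ^ n) \<longlonglongrightarrow> 0"
  proof (rule Lim_null_comparison)
    have "(\<lambda>n. norm (root2 (s n))) \<longlonglongrightarrow> norm (- 1 / 6 :: complex)"
      by (intro tendsto_norm r2)
    \<comment> \<open>Any bound strictly between 1/6 and 1 would serve; \<open>u n\<close> has
      modulus 1 since \<open>s n\<close> is imaginary.\<close>
    then have "\<forall>\<^sub>F n in sequentially. norm (root2 (s n)) < 1 / 2"
      by (rule order_tendstoD) simp
    then show "\<forall>\<^sub>F n in sequentially. norm ((root2 (s n) * u n) ^ n) \<le> (1 / 2) ^ n"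
    proof eventually_elim
      case (elim n)
      have "norm (u n) = 1" by (simp add: u_def s_def)
      then show ?case using elim by (simp add: norm_power norm_mult power_mono)
    qed
    show "(\<lambda>n. (1 / 2 :: real) ^ n) \<longlonglongrightarrow> 0" by (rule LIMSEQ_power_zero) simp
  qed
  have "(\<lambda>n. a n * (root1 (s n) * u n) ^ n + b n * (root2 (s n) * u n) ^ n)
      \<longlonglongrightarrow> 1 * exp (- (39 / 343) * complex_of_real v) + 0 * 0"
    by (intro tendsto_intros a b main small)
  moreover have "(\<lambda>n. root1 (s n) - root2 (s n)) \<longlonglongrightarrow> 7 / 6"
    by (rule tendsto_eq_intros r1 r2 refl | simp)+
  then have "\<forall>\<^sub>F n in sequentially. root1 (s n) - root2 (s n) \<noteq> 0"
    by (rule tendsto_imp_eventually_ne) simp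
  then have "\<forall>\<^sub>F n in sequentially. a n * (root1 (s n) * u n) ^ n + b n * (root2 (s n) * u n) ^ n =
      exp (- (2 / 7) * \<i> * \<theta> n) ^ n * loop_poly (exp (\<i> * \<theta> n)) n"
  proof eventually_elim
    case (elim n)
    have "loop_poly (exp (s n)) n = a n * root1 (s n) ^ n + b n * root2 (s n) ^ n"
      unfolding a_def b_def using elim by (intro loop_poly_roots root_sum root_prod) simp
    then show ?case
      by (simp add: power_mult_distrib algebra_simps) (simp add: s_def u_def algebra_simps)
  qed
  ultimately show ?thesis by (simp add: Lim_transform_eventually)
qed

section \<open>The limit law\<close>

text \<open>Two of the four sets of twisted edges have even size and act trivially; the two
  singletons act alike.\<close>

lemma sum_twist_step:
  fixes h :: "pairing \<Rightarrow> 'a :: comm_semiring_1"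
  shows "(\<Sum>S\<in>UNIV. h (twist_step S m)) = 2 * h m + 2 * h (twist_step {True} m)"
proof -
  have U: "(UNIV :: bool set set) = {{}, {True}, {False}, {True, False}}"
    unfolding Pow_UNIV[symmetric] UNIV_bool by (auto simp: Pow_insert)
  have "{True} \<noteq> {False}" "{True} \<noteq> {True, False}" "{False} \<noteq> {True, False}" by auto
  then show ?thesis
    by (subst U) (simp add: twist_step_def mult_2 add_ac)
qed

text \<open>The expectation of z to the number of loops in \<open>n\<close> further vertices, given
  the arriving pairing \<open>m\<close>; 24 = 6 * 4 counts the rotations and sets of twisted edges
  at a vertex.\<close>

fun chain_sum :: "complex \<Rightarrow> nat \<Rightarrow> pairing \<Rightarrow> complex" where
  "chain_sum z 0 m = 1"
| "chain_sum z (Suc n) m =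
    (\<Sum>c\<in>configs. z ^ loops (fst c) m * chain_sum z n (twist_step (snd c) (vertex_step (fst c) m))) / 24"

text \<open>From \<open>Own\<close> and \<open>Straight\<close> all 24 configurations yield
  different edges, split evenly by the twists. From \<open>Cross\<close> the 2 * 4 configurations of
  opposite type yield \<open>Own\<close>, and the 4 * 4 of adjacent type produce a loop and split
  evenly.\<close>

lemma sum_configs:
  fixes h :: "pairing \<Rightarrow> complex"
  shows "(\<Sum>c\<in>configs. z ^ loops (fst c) m * h (twist_step (snd c) (vertex_step (fst c) m))) =
    (case m of Cross \<Rightarrow> 8 * h Own + 8 * z * (h Cross + h Straight)
     | _ \<Rightarrow> 12 * (h Cross + h Straight))"
proof -
  define K where "K m = 2 * h m + 2 * h (twist_step {True} m)" for m
  define p where "p b = (if \<not> b \<and> m = Cross then z else 1) *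
    K (if b then (case m of Own \<Rightarrow> Cross | Straight \<Rightarrow> Straight | Cross \<Rightarrow> Own) else Cross)" for b
  have "(\<Sum>c\<in>configs. z ^ loops (fst c) m * h (twist_step (snd c) (vertex_step (fst c) m))) =
      (\<Sum>c\<in>four_cycles. z ^ loops c m * (\<Sum>S\<in>UNIV. h (twist_step S (vertex_step c m))))"
    by (simp add: configs_def sum_distrib_left sum.cartesian_product case_prod_unfold)
  also have "\<dots> = (\<Sum>c\<in>four_cycles. p (is_opp c))"
    unfolding sum_twist_step by (intro sum.cong) (auto simp: p_def K_def loops_def vertex_step_def)
  also have "\<dots> = 2 * p True + 4 * p False" by (rule sum_four_cycles)
  finally show ?thesis
    by (cases m) (simp_all add: p_def K_def twist_step_def algebra_simps)
qed

text \<open>The average over \<open>Cross\<close> and \<open>Straight\<close> for \<open>n\<close>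
  vertices is the value at \<open>Own\<close> for one more vertex, so the three-state system
  collapses to one recurrence of order two.\<close>

lemma chain_sum_Own: "chain_sum z n Own = loop_poly z n"
proof (induction n rule: induct_nat_012)
  case 1
  show ?case using sum_configs[of z Own "\<lambda>_. 1"] by simp
next
  case (ge2 n)
  have "chain_sum z (Suc (Suc n)) Own = (chain_sum z (Suc n) Cross + chain_sum z (Suc n) Straight) / 2"
    unfolding chain_sum.simps(2)[of z "Suc n"] sum_configs by simp
  also have "\<dots> = (1 / 2 + z / 3) * ((chain_sum z n Cross + chain_sum z n Straight) / 2) + chain_sum z n Own / 6"
    unfolding chain_sum.simps(2) sum_configs by (simp add: field_simps)
  also have "(chain_sum z n Cross + chain_sum z n Straight) / 2 = chain_sum z (Suc n) Own"
    unfolding chain_sum.simps(2) sum_configs by simp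
  finally show ?case using ge2 by simp
qed simp

lemma chain_state_cong: "(\<And>i. i < k \<Longrightarrow> g i = g' i) \<Longrightarrow> chain_state g k = chain_state g' k"
  by (induction k) auto

lemma sum_PiE_lessThan_Suc:
  "(\<Sum>g\<in>{..<Suc k} \<rightarrow>\<^sub>E A. f g) = (\<Sum>g\<in>{..<k} \<rightarrow>\<^sub>E A. \<Sum>c\<in>A. f (g(k := c)))"
proof -
  have inj: "inj_on (\<lambda>(y, g). g(k := y)) (A \<times> ({..<k} \<rightarrow>\<^sub>E A))"
    by (rule inj_combinator) simp
  have "(\<Sum>g\<in>{..<Suc k} \<rightarrow>\<^sub>E A. f g) = (\<Sum>(c, g)\<in>A \<times> ({..<k} \<rightarrow>\<^sub>E A). f (g(k := c)))"
    unfolding lessThan_Suc PiE_insert_eq sum.reindex[OF inj] by (simp add: case_prod_unfold)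
  also have "\<dots> = (\<Sum>c\<in>A. \<Sum>g\<in>{..<k} \<rightarrow>\<^sub>E A. f (g(k := c)))"
    by (rule sum.cartesian_product[symmetric])
  also have "\<dots> = (\<Sum>g\<in>{..<k} \<rightarrow>\<^sub>E A. \<Sum>c\<in>A. f (g(k := c)))"
    by (rule sum.swap)
  finally show ?thesis .
qed

text \<open>\<open>chain_state\<close> grows at the end of the chain whereas
  \<open>chain_sum\<close> unfolds at its start. With \<open>j\<close> vertices still to come, the
  induction hands one vertex at a time from the future to the past.\<close>

lemma sum_chain_state:
  "(\<Sum>g\<in>{..<k} \<rightarrow>\<^sub>E configs. z ^ snd (chain_state g k) * chain_sum z j (fst (chain_state g k))) =
   24 ^ k * chain_sum z (j + k) Own"
proof (induction k arbitrary: j)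
  case (Suc k)
  have chain_state: "chain_state (g(k := c)) (Suc k) =
    (twist_step (snd c) (vertex_step (fst c) (fst (chain_state g k))), snd (chain_state g k) + loops (fst c) (fst (chain_state g k)))"
    for g c
    using chain_state_cong[of k "g(k := c)" g] by (simp add: case_prod_unfold)
  have step: "24 * chain_sum z (Suc j) m =
      (\<Sum>c\<in>configs. z ^ loops (fst c) m * chain_sum z j (twist_step (snd c) (vertex_step (fst c) m)))" for m
    by simp
  have "(\<Sum>g\<in>{..<Suc k} \<rightarrow>\<^sub>E configs. z ^ snd (chain_state g (Suc k)) * chain_sum z j (fst (chain_state g (Suc k)))) =
      (\<Sum>g\<in>{..<k} \<rightarrow>\<^sub>E configs. z ^ snd (chain_state g k) * (24 * chain_sum z (Suc j) (fst (chain_state g k))))"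
    unfolding sum_PiE_lessThan_Suc chain_state
    by (simp only: step fst_conv snd_conv power_add mult.assoc sum_distrib_left)
  also have "\<dots> = 24 * (\<Sum>g\<in>{..<k} \<rightarrow>\<^sub>E configs. z ^ snd (chain_state g k) * chain_sum z (Suc j) (fst (chain_state g k)))"
    unfolding sum_distrib_left by (simp add: mult_ac)
  also have "\<dots> = 24 ^ Suc k * chain_sum z (j + Suc k) Own"
    unfolding Suc.IH by simp
  finally show ?case .
qed simp

lemma card_configs: "card configs = 24"
proof -
  \<comment> \<open>With \<open>z = 1\<close> and the constant function 1 the weighted sum merely
    counts: 12 * (1 + 1).\<close>
  have "of_nat (card configs) = (24 :: complex)"
    using sum_configs[of 1 Own "\<lambda>_. 1"] by simp
  then show ?thesis using of_nat_eq_iff[of "card configs" 24, where ?'a = complex] by simp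
qed

lemma sum_power_chain_state:
  "(\<Sum>g\<in>{..<n} \<rightarrow>\<^sub>E configs. z ^ snd (chain_state g n)) = 24 ^ n * loop_poly z n"
  using sum_chain_state[of z n 0] by (simp add: chain_sum_Own)

section \<open>The characteristic function of the Euler-genus\<close>

lemma min_degree_3_double_cycle:
  assumes "n > 0"
  shows "min_degree_3 (double_cycle n)"
proof
  fix v assume "v \<in> verts (double_cycle n)"
  then have v: "v < n" by simp
  have "inj (\<lambda>l. dart_of n (v, l))"
    by (rule inj_on_inverseI[where g = "\<lambda>d. snd (coord n d)"]) (simp add: v del: dart_of.simps)
  then have "card (darts_at (double_cycle n) v) = 4"
    unfolding darts_at_double_cycle[OF v] by (simp add: card_image)
  then show "3 \<le> card (darts_at (double_cycle n) v)" by simp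
qed (use assms in \<open>auto simp: double_cycle_def\<close>)

text \<open>With n vertices, 2n edges and f faces the Euler-genus is 2 + n - f; the summand 2 raises
  the error from 17 to 19.\<close>

lemma euler_genus_signed_rotation_of:
  assumes "n > 0" "g \<in> {..<n} \<rightarrow>\<^sub>E configs"
  shows "\<bar>euler_genus (double_cycle n) (signed_rotation_of n g) - (int n - int (snd (chain_state g n)))\<bar> \<le> 19"
proof -
  have g: "fst (g v) \<in> four_cycles" if "v < n" for v
    using assms(2) that by (auto simp: configs_def PiE_iff mem_Times_iff)
  have "card (faces (double_cycle n) (signed_rotation_of n g)) =
      ncomp (points 0 n) (chain_edges n g 0 \<union> gap_edges g (n - 1) 0)"
    by (rule card_faces_signed_rotation_of[OF assms(1)]) (rule g)
  moreover have "card (edges (double_cycle n)) = 2 * n" by (simp add: card_cartesian_product)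
  ultimately have "euler_genus (double_cycle n) (signed_rotation_of n g) =
      2 + int n - int (ncomp (points 0 n) (chain_edges n g 0 \<union> gap_edges g (n - 1) 0))"
    by (simp add: euler_genus_def)
  then show ?thesis using ncomp_closed_chain[of n g, OF assms(1) g] by simp
qed

lemma norm_iexp_diff_le: "norm (iexp a - iexp b) \<le> \<bar>a - b\<bar>"
proof -
  have "iexp a - iexp b = iexp b * (iexp (a - b) - 1)"
    by (simp add: algebra_simps flip: exp_add)
  then have "norm (iexp a - iexp b) = norm (iexp (a - b) - 1)" by (simp add: norm_mult)
  also have "\<dots> \<le> \<bar>a - b\<bar>" using iexp_approx1[of "a - b" 0] by simp
  finally show ?thesis .
qed

text \<open>Replacing the genus by n minus the number of loops turns the centring 5/7 n into 2/7 n,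
  and \<open>iexp\<close> is 1-Lipschitz. The sign of \<open>\<theta>\<close> is chosen so that
  loops enter with a plus.\<close>

lemma euler_genus_pmf_char_approx:
  assumes n: "n > 0"
  shows "norm ((LINT k|measure_pmf (euler_genus_pmf (double_cycle n)). iexp (- \<theta> * (real_of_int k - 5 / 7 * real n))) -
      exp (- (2 / 7) * \<i> * \<theta>) ^ n * loop_poly (exp (\<i> * \<theta>)) n) \<le> 19 * \<bar>\<theta>\<bar>"
proof -
  interpret min_degree_3 "double_cycle n" using n by (rule min_degree_3_double_cycle)
  let ?P = "{..<n} \<rightarrow>\<^sub>E configs" and ?S = "signed_rotations (double_cycle n)"
  let ?F = "\<lambda>k. iexp (- \<theta> * (real_of_int k - 5 / 7 * real n))"
  let ?X = "\<lambda>g. euler_genus (double_cycle n) (signed_rotation_of n g)"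
  have card: "card ?P = 24 ^ n" by (simp add: card_PiE card_configs)
  then have fin: "finite ?P" by (intro card_ge_0_finite) simp
  have cardS: "card ?S = 24 ^ n" using bij_betw_same_card[OF bij_betw_signed_rotation_of[of n]] card by simp
  then have ne: "?S \<noteq> {}" by auto
  have "(LINT k|measure_pmf (euler_genus_pmf (double_cycle n)). ?F k) = (\<Sum>g\<in>?P. ?F (?X g)) / 24 ^ n"
    unfolding integral_euler_genus_pmf[OF ne] cardS
    by (subst sum.reindex_bij_betw[OF bij_betw_signed_rotation_of[of n], symmetric]) simp
  moreover have "exp (- (2 / 7) * \<i> * \<theta>) ^ n * loop_poly (exp (\<i> * \<theta>)) n =
      (\<Sum>g\<in>?P. iexp (- \<theta> * (2 / 7 * real n - real (snd (chain_state g n))))) / 24 ^ n"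
  proof -
    have "iexp (- \<theta> * (2 / 7 * real n - real (snd (chain_state g n)))) =
        exp (- (2 / 7) * \<i> * \<theta>) ^ n * exp (\<i> * \<theta>) ^ snd (chain_state g n)" for g
      by (simp add: algebra_simps flip: exp_of_nat_mult exp_add)
    then show ?thesis
      by (simp add: sum_power_chain_state flip: sum_distrib_left)
  qed
  moreover have "norm (\<Sum>g\<in>?P. ?F (?X g) - iexp (- \<theta> * (2 / 7 * real n - real (snd (chain_state g n))))) \<le>
      real (card ?P) * (19 * \<bar>\<theta>\<bar>)"
  proof (rule sum_norm_bound)
    fix g assume "g \<in> ?P"
    have "norm (?F (?X g) - iexp (- \<theta> * (2 / 7 * real n - real (snd (chain_state g n))))) \<le>
        \<bar>- \<theta> * (real_of_int (?X g) - 5 / 7 * real n) - - \<theta> * (2 / 7 * real n - real (snd (chain_state g n)))\<bar>"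
      by (rule norm_iexp_diff_le)
    also have "\<dots> = \<bar>- \<theta> * (real_of_int (?X g) - (real n - real (snd (chain_state g n))))\<bar>"
      by (rule arg_cong[of _ _ abs]) (simp add: field_simps)
    also have "\<dots> = \<bar>\<theta>\<bar> * real_of_int \<bar>?X g - (int n - int (snd (chain_state g n)))\<bar>"
      by (simp add: abs_mult)
    also have "\<dots> \<le> \<bar>\<theta>\<bar> * real_of_int 19"
      using euler_genus_signed_rotation_of[OF n \<open>g \<in> ?P\<close>] by (intro mult_left_mono of_int_le_iff[THEN iffD2]) auto
    finally show "norm (?F (?X g) - iexp (- \<theta> * (2 / 7 * real n - real (snd (chain_state g n))))) \<le> 19 * \<bar>\<theta>\<bar>"
      by simp
  qed
  ultimately show ?thesis
    by (simp add: card norm_divide norm_power pos_divide_le_eq mult.commute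
        flip: diff_divide_distrib sum_subtractf)
qed

theorem theorem5p2:
  shows "asymptotically_normal
           (\<lambda>n. map_pmf real_of_int (euler_genus_pmf (double_cycle n)))
           (\<lambda>n. 5 / 7 * real n) (\<lambda>n. 78 / 343 * real n)"
  unfolding asymptotically_normal_def
proof (rule levy_continuity)
  let ?M = "\<lambda>n. distr (measure_pmf (map_pmf real_of_int (euler_genus_pmf (double_cycle n)))) borel
    (\<lambda>x. (x - 5 / 7 * real n) / sqrt (78 / 343 * real n))"
  show "real_distribution (?M n)" for n
    by (rule prob_space.real_distribution_distr[OF prob_space_measure_pmf]) simp
  show "real_distribution std_normal_distribution" by (rule real_dist_normal_dist)
  fix t :: real
  define \<theta> where "\<theta> n = - t / sqrt (78 / 343 * real n)" for n
  have char: "char (?M n) t = (LINT k|measure_pmf (euler_genus_pmf (double_cycle n)).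
      iexp (- \<theta> n * (real_of_int k - 5 / 7 * real n)))" for n
    unfolding char_def by (subst integral_distr) (simp_all add: \<theta>_def)
  have \<theta>0: "\<theta> \<longlonglongrightarrow> 0"
  proof -
    have "filterlim (\<lambda>n. sqrt (78 / 343 * real n)) at_top sequentially"
      by (intro filterlim_compose[OF sqrt_at_top] filterlim_tendsto_pos_mult_at_top[OF tendsto_const]
          filterlim_real_sequentially) simp
    then show ?thesis unfolding \<theta>_def
      by (intro real_tendsto_divide_at_top[OF tendsto_const])
  qed
  show "(\<lambda>n. char (?M n) t) \<longlonglongrightarrow> char std_normal_distribution t"
  \<comment> \<open>The expansion of the root divides by the square of \<open>\<theta> n\<close>,
    which vanishes for \<open>t = 0\<close>.\<close>
  proof (cases "t = 0")
    case True
    then have "char (?M n) t = 1" for n unfolding char by (simp add: \<theta>_def)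
    then show ?thesis using True by (simp add: char_std_normal_distribution)
  next
    case False
    let ?a = "\<lambda>n. exp (- (2 / 7) * \<i> * \<theta> n) ^ n * loop_poly (exp (\<i> * \<theta> n)) n"
    \<comment> \<open>The constants combine to 39/343 * 343/78 = 1/2, the exponent of the standard
      normal law.\<close>
    have "?a \<longlonglongrightarrow> exp (- (39 / 343) * complex_of_real (343 / 78 * t\<^sup>2))"
    proof (rule loop_poly_asymptotics[OF \<theta>0])
      show "\<theta> n \<noteq> 0" if "n > 0" for n using that False by (simp add: \<theta>_def)
      have "\<forall>\<^sub>F n in sequentially. 343 / 78 * t\<^sup>2 = real n * (\<theta> n)\<^sup>2"
        using eventually_gt_at_top[of 0]
        by eventually_elim (simp add: \<theta>_def power_divide)
      then show "(\<lambda>n. real n * (\<theta> n)\<^sup>2) \<longlonglongrightarrow> 343 / 78 * t\<^sup>2"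
        by (rule Lim_transform_eventually[OF tendsto_const])
    qed
    moreover have "exp (- (39 / 343) * complex_of_real (343 / 78 * t\<^sup>2)) = char std_normal_distribution t"
      by (simp add: char_std_normal_distribution flip: exp_of_real)
    moreover have "(\<lambda>n. char (?M n) t - ?a n) \<longlonglongrightarrow> 0"
    proof (rule Lim_null_comparison)
      show "\<forall>\<^sub>F n in sequentially. norm (char (?M n) t - ?a n) \<le> 19 * \<bar>\<theta> n\<bar>"
        using eventually_gt_at_top[of 0]
        by eventually_elim (unfold char, rule euler_genus_pmf_char_approx)
      show "(\<lambda>n. 19 * \<bar>\<theta> n\<bar>) \<longlonglongrightarrow> 0"
        using tendsto_mult[OF tendsto_const tendsto_rabs[OF \<theta>0], of 19] by simp
    qed
    ultimately show ?thesis
      using tendsto_add[of "\<lambda>n. char (?M n) t - ?a n" 0 sequentially ?a] by simp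
  qed
qed

end
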